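(* $(\mathcal{T}_\Omega^\circ,\unlhd,\Delta^* )$ is the bialgebra dual to $(\mathcal{T}_\Omega,\mathbin{\sqcup\!\sqcup}^T,\Delta)$ as a bialgebra. That is, $(\mathcal{T}_\Omega^\circ,\unlhd,\Delta^* )$ is a bialgebra whose coproduct $\Delta^*$ is dual to $\mathbin{\sqcup\!\sqcup}^T$ and whose product $\unlhd$ is dual to $\Delta$: for all $T_1,T_2\in\mathcal{T}_\Omega^\circ$ and all $T\in\mathcal{T}_\Omega$, $\langle T_1\unlhd T_2,T\rangle=\langle T_1\otimes T_2,\Delta(T)\rangle$.
   Context: $\mathbb{K}$ is a field and $\Omega$ is a finite set (more generally, one may assume that each space of forests with $n$ vertices is itself graded with finite-dimensional components). Rooted forests are finite, non-planar (up to isomorphism), with vertices decorated by $\Omega$. $\mathcal{F}_\Omega$ is the $\mathbb{K}$-vector space freely generated by rooted forests; $\mathcal{T}_\Omega$ is the subspace spanned by rooted trees, including the empty tree $\emptyset$. Concatenation (disjoint union) of forests is written by juxtaposition. $B_+^a$ ($a\in\Omega$) sends a forest $T_1\cdots T_k$ to the tree obtained by adding a new root decorated by $a$ linked to the root of each $T_i$. The shuffle product $\mathbin{\sqcup\!\sqcup}^T$ is the bilinear product on $\mathcal{F}_\Omega$ defined recursively by: $F\mathbin{\sqcup\!\sqcup}^T\emptyset=\emptyset\mathbin{\sqcup\!\sqcup}^T F=F$; if $F=T_1\cdots T_k$, $F'=t_1\cdots t_n$ with non-empty trees, $k,n\ge1$ and $k+n\ge3$, $F\mathbin{\sqcup\!\sqcup}^T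 F'=\frac1{kn}\sum_{i=1}^k\sum_{j=1}^n(T_i\mathbin{\sqcup\!\sqcup}^T t_j)T_1\cdots\widehat{T_i}\cdots T_k t_1\cdots\widehat{t_j}\cdots t_n$ (hats denote omission); and for non-empty trees $T=B_+^a(f)$, $T'=B_+^{a'}(f')$, $T\mathbin{\sqcup\!\sqcup}^T T'=B_+^a(f\mathbin{\sqcup\!\sqcup}^T T')+B_+^{a'}(T\mathbin{\sqcup\!\sqcup}^T f')$. It restricts to $\mathcal{T}_\Omega$. The coproduct $\Delta$ on $\mathcal{T}_\Omega$ is the linear map defined inductively by $\Delta(\emptyset)=\emptyset\otimes\emptyset$; $\Delta(B_+^a(t))=(B_+^a\otimes\mathrm{Id})\Delta(t)+\emptyset\otimes B_+^a(t)$ if $t$ is a (possibly empty) tree; $\Delta(B_+^a(f))=\emptyset\otimes B_+^a(f)$ if $f$ is a non-connected forest. $\mathcal{T}_\Omega^\circ$ is the graded dual of $\mathcal{T}_\Omega$ (graded by number of vertices). A tree $T$ viewed in $\mathcal{T}_\Omega^\circ$ denotes the dual basis element: $\langle T,T'\rangle=1$ if $T=T'$ and $0$ otherwise. $\Delta^*$ is the coproduct on $\mathcal{T}_\Omega^\circ$ with $\langle\Delta^*(T),a\otimes b\rangle=\langle T,a\mathbin{\sqcup\!\sqcup}^T b\rangle$. $\ell(T)$ is the set of leaves of $T$ and, for two trees $T$, $T'$ and $v\in V(T)$, $T\underset{v}{\curvearrowleft}T'$ is the tree obtained by grafting the root of $T'$ as a new direct descendant of $v$. The bilinear product $\unlhd$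 on $\mathcal{T}_\Omega^\circ$ is defined on trees by $\emptyset\unlhd T'=T'$; $T\unlhd T'=0$ if $|\ell(T)|>1$; $T\unlhd T'=T\underset{l}{\curvearrowleft}T'$ if $T$ has a unique leaf $l$. For a (not necessarily associative) algebra $(B,m)$, a bialgebra structure means a coproduct $\Delta_B:B\to B\otimes B$ (not necessarily coassociative here) with a counit, satisfying the compatibility $\Delta_B\circ m=(m\otimes m)\circ\tau_{23}\circ(\Delta_B\otimes\Delta_B)$, where $\tau_{23}(a\otimes b\otimes c\otimes d)=a\otimes c\otimes b\otimes d$. *)

theory Defs
  imports "HOL-Library.Multiset" "HOL-Library.Poly_Mapping" "HOL-Library.FuncSet"
begin

section \<open>Linear algebra on free vector spaces\<close>

text \<open>
  The free vector space on a basis type \<open>'b\<close> is \<open>'b \<Rightarrow>\<^sub>0 'k\<close>; a basis element \<open>b\<close> is the vector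
  \<open>single b 1\<close>. The tensor product of the free spaces on \<open>'b\<close> and \<open>'c\<close> is the free space on
  \<open>'b \<times> 'c\<close>, the pair \<open>(b, c)\<close> being the basis element \<open>b \<otimes> c\<close>.
\<close>

definition scale :: "'k::field \<Rightarrow> ('b \<Rightarrow>\<^sub>0 'k) \<Rightarrow> ('b \<Rightarrow>\<^sub>0 'k)" where
  "scale c x = Poly_Mapping.map ((*) c) x"

text \<open>The subspace spanned by the basis elements in \<open>X\<close>.\<close>

definition free_on :: "'b set \<Rightarrow> ('b \<Rightarrow>\<^sub>0 'k::field) set" where
  "free_on X = {x. Poly_Mapping.keys x \<subseteq> X}"

text \<open>\<open>s\<close> is the scalar multiplication of the target, so that \<open>s = (*)\<close> for linear forms.\<close>

definition linear_on ::
  "('b \<Rightarrow>\<^sub>0 'k::field) set \<Rightarrow> ('k \<Rightarrow> 'v \<Rightarrow> 'v::ab_group_add) \<Rightarrow> (('b \<Rightarrow>\<^sub>0 'k) \<Rightarrow> 'v) \<Rightarrow> bool" where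
  "linear_on V s f \<longleftrightarrow>
     (\<forall>x\<in>V. \<forall>y\<in>V. f (x + y) = f x + f y) \<and> (\<forall>c. \<forall>x\<in>V. f (scale c x) = s c (f x))"

text \<open>The linear extension of a map given on the basis.\<close>

definition lin_ext :: "('b \<Rightarrow> ('c \<Rightarrow>\<^sub>0 'k::field)) \<Rightarrow> ('b \<Rightarrow>\<^sub>0 'k) \<Rightarrow> ('c \<Rightarrow>\<^sub>0 'k)" where
  "lin_ext g x = (\<Sum>b\<in>Poly_Mapping.keys x. scale (Poly_Mapping.lookup x b) (g b))"

definition bilin_ext ::
  "('b \<Rightarrow> 'c \<Rightarrow> ('d \<Rightarrow>\<^sub>0 'k::field)) \<Rightarrow> ('b \<Rightarrow>\<^sub>0 'k) \<Rightarrow> ('c \<Rightarrow>\<^sub>0 'k) \<Rightarrow> ('d \<Rightarrow>\<^sub>0 'k)" where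
  "bilin_ext g x y = lin_ext (\<lambda>b. lin_ext (g b) y) x"

definition tensor :: "('b \<Rightarrow>\<^sub>0 'k::field) \<Rightarrow> ('c \<Rightarrow>\<^sub>0 'k) \<Rightarrow> ('b \<times> 'c \<Rightarrow>\<^sub>0 'k)" where
  "tensor = bilin_ext (\<lambda>b c. Poly_Mapping.single (b, c) 1)"

text \<open>The tensor product \<open>f \<otimes> g\<close> of two linear maps.\<close>

definition tensor_map ::
  "(('b \<Rightarrow>\<^sub>0 'k::field) \<Rightarrow> ('d \<Rightarrow>\<^sub>0 'k)) \<Rightarrow> (('c \<Rightarrow>\<^sub>0 'k) \<Rightarrow> ('e \<Rightarrow>\<^sub>0 'k)) \<Rightarrow>
   ('b \<times> 'c \<Rightarrow>\<^sub>0 'k) \<Rightarrow> ('d \<times> 'e \<Rightarrow>\<^sub>0 'k)" where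
  "tensor_map f g =
     lin_ext (\<lambda>(b, c). tensor (f (Poly_Mapping.single b 1)) (g (Poly_Mapping.single c 1)))"

text \<open>The linear map on the tensor product induced by a bilinear map.\<close>

definition on_tensor ::
  "(('b \<Rightarrow>\<^sub>0 'k::field) \<Rightarrow> ('c \<Rightarrow>\<^sub>0 'k) \<Rightarrow> ('d \<Rightarrow>\<^sub>0 'k)) \<Rightarrow> ('b \<times> 'c \<Rightarrow>\<^sub>0 'k) \<Rightarrow> ('d \<Rightarrow>\<^sub>0 'k)" where
  "on_tensor m = lin_ext (\<lambda>(b, c). m (Poly_Mapping.single b 1) (Poly_Mapping.single c 1))"

definition tau23 ::
  "(('b \<times> 'c) \<times> ('d \<times> 'e) \<Rightarrow>\<^sub>0 'k::field) \<Rightarrow> (('b \<times> 'd) \<times> ('c \<times> 'e) \<Rightarrow>\<^sub>0 'k)" where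
  "tau23 = lin_ext (\<lambda>((a, b), (c, d)). Poly_Mapping.single ((a, c), (b, d)) 1)"

text \<open>
  \<open>\<epsilon>\<close> is a (two-sided) counit: \<open>(\<epsilon> \<otimes> Id) \<circ> D = Id = (Id \<otimes> \<epsilon>) \<circ> D\<close>, where \<open>K \<otimes> V\<close> and
  \<open>V \<otimes> K\<close> are identified with \<open>V\<close>.
\<close>

definition is_counit ::
  "'b set \<Rightarrow> (('b \<Rightarrow>\<^sub>0 'k::field) \<Rightarrow> ('b \<times> 'b \<Rightarrow>\<^sub>0 'k)) \<Rightarrow> (('b \<Rightarrow>\<^sub>0 'k) \<Rightarrow> 'k) \<Rightarrow> bool" where
  "is_counit X D \<epsilon> \<longleftrightarrow> linear_on (free_on X) (*) \<epsilon> \<and>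
     (\<forall>x\<in>free_on X.
        lin_ext (\<lambda>(b, c). scale (\<epsilon> (Poly_Mapping.single b 1)) (Poly_Mapping.single c 1)) (D x) = x \<and>
        lin_ext (\<lambda>(b, c). scale (\<epsilon> (Poly_Mapping.single c 1)) (Poly_Mapping.single b 1)) (D x) = x)"

text \<open>
  Bialgebra structure on the space \<open>V\<close> with basis \<open>X\<close>; the product need be neither associative nor
  unital, and the coproduct need not be coassociative.
\<close>

definition is_bialgebra ::
  "'b set \<Rightarrow> (('b \<Rightarrow>\<^sub>0 'k::field) \<Rightarrow> ('b \<Rightarrow>\<^sub>0 'k) \<Rightarrow> ('b \<Rightarrow>\<^sub>0 'k)) \<Rightarrow>
   (('b \<Rightarrow>\<^sub>0 'k) \<Rightarrow> ('b \<times> 'b \<Rightarrow>\<^sub>0 'k)) \<Rightarrow> bool" where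
  "is_bialgebra X m D \<longleftrightarrow> (let V = free_on X in
     (\<forall>x\<in>V. \<forall>y\<in>V. m x y \<in> V) \<and>
     (\<forall>x\<in>V. linear_on V scale (m x)) \<and> (\<forall>y\<in>V. linear_on V scale (\<lambda>x. m x y)) \<and>
     (\<forall>x\<in>V. D x \<in> free_on (X \<times> X)) \<and> linear_on V scale D \<and>
     (\<exists>\<epsilon>. is_counit X D \<epsilon>) \<and>
     (\<forall>z\<in>free_on (X \<times> X).
        D (on_tensor m z) = tensor_map (on_tensor m) (on_tensor m) (tau23 (tensor_map D D z))))"


section \<open>Rooted trees and forests\<close>

text \<open>
  \<open>B_plus a f\<close> is \<open>B\<^sub>+\<^sup>a(f)\<close>. A rooted forest is a multiset of non-empty trees, disjoint union being
  \<open>+\<close>. The empty tree \<open>\<emptyset>\<close> is the empty forest, and the trees (including \<open>\<emptyset>\<close>) are the forests with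
  at most one component. On \<open>'a forest \<Rightarrow>\<^sub>0 'k\<close> the product \<open>*\<close> of the library is the bilinear
  extension of the disjoint union.
\<close>

datatype 'a rtree = B_plus 'a "'a rtree multiset"

type_synonym 'a forest = "'a rtree multiset"

primrec num_vertices :: "'a rtree \<Rightarrow> nat" where
  "num_vertices (B_plus a f) = Suc (\<Sum>\<^sub># (image_mset num_vertices f))"

primrec num_leaves :: "'a rtree \<Rightarrow> nat" where
  "num_leaves (B_plus a f) = (if f = {#} then 1 else \<Sum>\<^sub># (image_mset num_leaves f))"

definition forest_vertices :: "'a forest \<Rightarrow> nat" where
  "forest_vertices F = (\<Sum>T\<in>#F. num_vertices T)"

definition forest_leaves :: "'a forest \<Rightarrow> nat" where
  "forest_leaves F = (\<Sum>T\<in>#F. num_leaves T)"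

definition trees :: "'a set \<Rightarrow> 'a forest set" where
  "trees \<Omega> = {F. size F \<le> 1 \<and> (\<forall>T\<in>#F. set_rtree T \<subseteq> \<Omega>)}"

abbreviation T_space :: "'a set \<Rightarrow> ('a forest \<Rightarrow>\<^sub>0 'k::field) set" where
  "T_space \<Omega> \<equiv> free_on (trees \<Omega>)"

definition B_plus_lin :: "'a \<Rightarrow> ('a forest \<Rightarrow>\<^sub>0 'k::field) \<Rightarrow> ('a forest \<Rightarrow>\<^sub>0 'k)" where
  "B_plus_lin a = lin_ext (\<lambda>f. Poly_Mapping.single {#B_plus a f#} 1)"


section \<open>The shuffle product and the coproduct\<close>

lemma forest_vertices_simps [simp]:
  "forest_vertices {#} = 0"
  "forest_vertices (add_mset T F) = num_vertices T + forest_vertices F"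
  by (simp_all add: forest_vertices_def)

lemma num_vertices_B_plus [simp]:
  "num_vertices (B_plus a f) = Suc (forest_vertices f)"
  by (simp add: forest_vertices_def)

declare num_vertices.simps [simp del]

lemma num_vertices_pos [simp]: "num_vertices T > 0"
  by (cases T) simp

lemma forest_vertices_pos: "F \<noteq> {#} \<Longrightarrow> forest_vertices F > 0"
  by (cases F) auto

lemma forest_vertices_decrease:
  assumes "T \<in># F" "t \<in># F'" "size F + size F' \<ge> 3"
  shows "num_vertices T + num_vertices t < forest_vertices F + forest_vertices F'"
proof -
  obtain G where G: "F = add_mset T G" using assms(1) by (meson mset_add)
  obtain G' where G': "F' = add_mset t G'" using assms(2) by (meson mset_add)
  have "G \<noteq> {#} \<or> G' \<noteq> {#}" using assms(3) G G' by auto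
  then show ?thesis using G G' forest_vertices_pos[of G] forest_vertices_pos[of G'] by auto
qed

text \<open>
  The sums over \<open>T \<in># F\<close> and \<open>t \<in># F'\<close> count multiplicities, as do the sums over the indices
  \<open>1 \<le> i \<le> k\<close>, \<open>1 \<le> j \<le> n\<close> for \<open>F = T\<^sub>1\<dots>T\<^sub>k\<close>, \<open>F' = t\<^sub>1\<dots>t\<^sub>n\<close>. In positive characteristic the
  coefficient \<open>1/(kn)\<close> is read with the convention \<open>1/0 = 0\<close>.
\<close>

function shuffle_basis :: "'a forest \<Rightarrow> 'a forest \<Rightarrow> ('a forest \<Rightarrow>\<^sub>0 'k::field)" where
  "shuffle_basis F {#} = Poly_Mapping.single F 1"
| "F' \<noteq> {#} \<Longrightarrow> shuffle_basis {#} F' = Poly_Mapping.single F' 1"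
| "shuffle_basis {#B_plus a f#} {#B_plus a' f'#} =
     B_plus_lin a (shuffle_basis f {#B_plus a' f'#}) +
     B_plus_lin a' (shuffle_basis {#B_plus a f#} f')"
| "\<lbrakk>F \<noteq> {#}; F' \<noteq> {#}; size F + size F' \<ge> 3\<rbrakk> \<Longrightarrow> shuffle_basis F F' =
     scale (1 / (of_nat (size F) * of_nat (size F')))
       (\<Sum>T\<in>#F. \<Sum>t\<in>#F'.
          shuffle_basis {#T#} {#t#} * Poly_Mapping.single ((F - {#T#}) + (F' - {#t#})) 1)"
proof goal_cases
  case (1 P x)
  obtain F F' where x: "x = (F, F')" by fastforce
  show ?case
  proof (cases "F = {#} \<or> F' = {#} \<or> size F + size F' \<ge> 3")
    case True
    then show ?thesis using 1 x by metis
  next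
    case False
    then have "size F \<noteq> 0" "size F' \<noteq> 0" "size F + size F' < 3" by auto
    then have "size F = 1" "size F' = 1" by linarith+
    then obtain T t where "F = {#T#}" "F' = {#t#}" by (metis One_nat_def size_1_singleton_mset)
    then show ?thesis using 1(3) x by (metis rtree.exhaust)
  qed
qed auto
termination
  by (relation "measure (\<lambda>(F, F'). forest_vertices F + forest_vertices F')")
     (auto dest: forest_vertices_decrease)

definition shuffle ::
  "('a forest \<Rightarrow>\<^sub>0 'k::field) \<Rightarrow> ('a forest \<Rightarrow>\<^sub>0 'k) \<Rightarrow> ('a forest \<Rightarrow>\<^sub>0 'k)" where
  "shuffle = bilin_ext shuffle_basis"

text \<open>
  \<open>\<Delta>\<close> is only meant on trees; the value on forests with several components is immaterial.
\<close>

function Delta_basis :: "'a forest \<Rightarrow> ('a forest \<times> 'a forest \<Rightarrow>\<^sub>0 'k::field)" where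
  "Delta_basis {#} = Poly_Mapping.single ({#}, {#}) 1"
| "size t \<le> 1 \<Longrightarrow> Delta_basis {#B_plus a t#} =
     tensor_map (B_plus_lin a) (\<lambda>x. x) (Delta_basis t) +
     Poly_Mapping.single ({#}, {#B_plus a t#}) 1"
| "size f \<ge> 2 \<Longrightarrow> Delta_basis {#B_plus a f#} = Poly_Mapping.single ({#}, {#B_plus a f#}) 1"
| "size F \<ge> 2 \<Longrightarrow> Delta_basis F = 0"
proof goal_cases
  case (1 P F)
  show ?case
  proof (cases "F = {#} \<or> size F \<ge> 2")
    case True
    then show ?thesis using 1 by metis
  next
    case False
    then have "size F \<noteq> 0" "size F < 2" by auto
    then have "size F = 1" by linarith
    then obtain a f where "F = {#B_plus a f#}"
      by (metis One_nat_def size_1_singleton_mset rtree.exhaust)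
    then show ?thesis using 1(2,3) by (metis not_less_eq_eq numeral_2_eq_2 One_nat_def)
  qed
qed auto
termination
  by (relation "measure forest_vertices") auto

definition Delta :: "('a forest \<Rightarrow>\<^sub>0 'k::field) \<Rightarrow> ('a forest \<times> 'a forest \<Rightarrow>\<^sub>0 'k)" where
  "Delta = lin_ext Delta_basis"


section \<open>The graded dual\<close>

definition pairing :: "('b \<Rightarrow>\<^sub>0 'k::field) \<Rightarrow> ('b \<Rightarrow>\<^sub>0 'k) \<Rightarrow> 'k" where
  "pairing f x = (\<Sum>b\<in>Poly_Mapping.keys f. Poly_Mapping.lookup f b * Poly_Mapping.lookup x b)"

text \<open>
  The graded dual: the linear forms on \<open>T_space \<Omega>\<close> vanishing on all but finitely many homogeneous
  components, the degree being the number of vertices.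
\<close>

definition graded_dual :: "'a set \<Rightarrow> (('a forest \<Rightarrow>\<^sub>0 'k::field) \<Rightarrow> 'k) set" where
  "graded_dual \<Omega> = {\<phi> \<in> extensional (T_space \<Omega>). linear_on (T_space \<Omega>) (*) \<phi> \<and>
     finite {n. \<exists>x\<in>free_on {F \<in> trees \<Omega>. forest_vertices F = n}. \<phi> x \<noteq> 0}}"

text \<open>
  As \<open>\<Omega>\<close> is finite, the graded dual has the dual basis of the trees as a basis. So we represent it
  by the free space on trees as well, a tree standing for the dual basis element, and evaluation of
  forms being \<open>pairing\<close>; see lemma \<open>graded_dual_iso\<close> below.
\<close>

definition T_dual :: "'a set \<Rightarrow> ('a forest \<Rightarrow>\<^sub>0 'k::field) set" where
  "T_dual \<Omega> = free_on (trees \<Omega>)"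

lemma scale_lookup [simp]: "Poly_Mapping.lookup (scale c x) b = c * Poly_Mapping.lookup x b"
  by (simp add: scale_def Poly_Mapping.map.rep_eq when_def)

lemma pairing_single_right: "pairing f (Poly_Mapping.single b 1) = Poly_Mapping.lookup f b"
proof -
  have "pairing f (Poly_Mapping.single b 1) =
      (\<Sum>c\<in>Poly_Mapping.keys f. if c = b then Poly_Mapping.lookup f c else 0)"
    unfolding pairing_def by (intro sum.cong) (auto simp: lookup_single)
  then show ?thesis by (simp add: in_keys_iff)
qed

lemma linear_on_pairing: "linear_on V (*) (pairing f)"
  by (simp add: linear_on_def pairing_def lookup_add distrib_left sum.distrib sum_distrib_left
      mult.left_commute)

lemma linear_on_free_on_eqI:
  assumes "linear_on (free_on X) (*) \<phi>" "linear_on (free_on X) (*) \<psi>"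
    and eq: "\<And>b. b \<in> X \<Longrightarrow> \<phi> (Poly_Mapping.single b 1) = \<psi> (Poly_Mapping.single b 1)"
    and x: "x \<in> free_on X"
  shows "\<phi> x = \<psi> x"
  using x
proof (induction "card (Poly_Mapping.keys x)" arbitrary: x rule: less_induct)
  case less
  note add = assms(1,2)[unfolded linear_on_def, THEN conjunct1, rule_format]
  note scl = assms(1,2)[unfolded linear_on_def, THEN conjunct2, rule_format]
  show ?case
  proof (cases "Poly_Mapping.keys x = {}")
    case True
    then have "x = scale 0 x" by (intro poly_mapping_eqI) (simp add: in_keys_iff[symmetric] not_in_keys_iff_lookup_eq_zero[symmetric])
    then show ?thesis using scl less.prems by (metis mult_zero_left)
  next
    case False
    then obtain b where b: "b \<in> Poly_Mapping.keys x" by blast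
    define s where "s = Poly_Mapping.single b (1::'b)"
    define y where "y = x - scale (Poly_Mapping.lookup x b) s"
    have ky: "Poly_Mapping.keys y = Poly_Mapping.keys x - {b}"
      by (auto simp: y_def s_def in_keys_iff lookup_minus lookup_single when_def split: if_splits)
    have bX: "b \<in> X" using b less.prems by (auto simp: free_on_def)
    then have sV: "s \<in> free_on X" "scale (Poly_Mapping.lookup x b) s \<in> free_on X"
      by (auto simp: s_def free_on_def in_keys_iff lookup_single when_def split: if_splits)
    have yV: "y \<in> free_on X" using ky less.prems by (auto simp: free_on_def)
    have "card (Poly_Mapping.keys y) < card (Poly_Mapping.keys x)"
      unfolding ky using b by (meson card_Diff1_less finite_keys)
    then have "\<phi> y = \<psi> y" using less.hyps yV by blast
    moreover have "x = y + scale (Poly_Mapping.lookup x b) s" by (simp add: y_def)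
    moreover have "\<phi> s = \<psi> s" using eq bX by (simp add: s_def)
    ultimately show ?thesis using add[OF yV sV(2)] scl[OF sV(1)] by metis
  qed
qed

lemma finite_msets_bounded:
  assumes "finite A"
  shows "finite {F. set_mset F \<subseteq> A \<and> size F \<le> n}"
proof (induction n)
  case 0
  have "{F. set_mset F \<subseteq> A \<and> size F \<le> 0} \<subseteq> {{#}}" by auto
  then show ?case using finite_subset by blast
next
  case (Suc n)
  have "{F. set_mset F \<subseteq> A \<and> size F \<le> Suc n} \<subseteq>
      insert {#} ((\<lambda>(T, F). add_mset T F) ` (A \<times> {F. set_mset F \<subseteq> A \<and> size F \<le> n}))"
  proof
    fix F assume F: "F \<in> {F. set_mset F \<subseteq> A \<and> size F \<le> Suc n}"
    show "F \<in> insert {#} ((\<lambda>(T, F). add_mset T F) ` (A \<times> {F. set_mset F \<subseteq> A \<and> size F \<le> n}))"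
      using F by (cases F) auto
  qed
  moreover have "finite (insert {#} ((\<lambda>(T, F). add_mset T F) `
      (A \<times> {F. set_mset F \<subseteq> A \<and> size F \<le> n})))"
    using Suc assms by simp
  ultimately show ?case using finite_subset by blast
qed

lemma size_le_forest_vertices: "size F \<le> forest_vertices F"
proof (induction F)
  case (add T F)
  then show ?case using num_vertices_pos[of T] by (simp del: num_vertices_pos)
qed simp

lemma num_vertices_le_forest_vertices: "T \<in># F \<Longrightarrow> num_vertices T \<le> forest_vertices F"
  by (metis forest_vertices_simps(2) le_add1 mset_add)

lemma finite_rtrees:
  assumes "finite \<Omega>"
  shows "finite {T. set_rtree T \<subseteq> \<Omega> \<and> num_vertices T \<le> n}"
proof (induction n)
  case 0
  have "{T. set_rtree T \<subseteq> \<Omega> \<and> num_vertices T \<le> 0} = {}"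
    using num_vertices_pos not_le by blast
  then show ?case by (metis finite.emptyI)
next
  case (Suc n)
  let ?A = "{T. set_rtree T \<subseteq> \<Omega> \<and> num_vertices T \<le> n}"
  have "{T. set_rtree T \<subseteq> \<Omega> \<and> num_vertices T \<le> Suc n} \<subseteq>
      (\<lambda>(a, f). B_plus a f) ` (\<Omega> \<times> {F. set_mset F \<subseteq> ?A \<and> size F \<le> n})"
  proof
    fix T assume T: "T \<in> {T. set_rtree T \<subseteq> \<Omega> \<and> num_vertices T \<le> Suc n}"
    obtain a f where af: "T = B_plus a f" by (cases T)
    have "a \<in> \<Omega>" "size f \<le> n" using T af size_le_forest_vertices[of f] by auto
    moreover have "set_mset f \<subseteq> ?A"
      using T af num_vertices_le_forest_vertices[of _ f] by (fastforce intro: order_trans)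
    ultimately show "T \<in> (\<lambda>(a, f). B_plus a f) ` (\<Omega> \<times> {F. set_mset F \<subseteq> ?A \<and> size F \<le> n})"
      using af by auto
  qed
  moreover have "finite ((\<lambda>(a, f). B_plus a f) ` (\<Omega> \<times> {F. set_mset F \<subseteq> ?A \<and> size F \<le> n}))"
    using assms finite_msets_bounded[OF Suc] by blast
  ultimately show ?case using finite_subset by blast
qed

lemma finite_trees_of_size:
  assumes "finite \<Omega>"
  shows "finite {F \<in> trees \<Omega>. forest_vertices F = n}"
proof -
  have "{F \<in> trees \<Omega>. forest_vertices F = n} \<subseteq>
      {F. set_mset F \<subseteq> {T. set_rtree T \<subseteq> \<Omega> \<and> num_vertices T \<le> n} \<and> size F \<le> 1}"
    by (auto simp: trees_def intro: num_vertices_le_forest_vertices)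
  then show ?thesis
    using finite_msets_bounded[OF finite_rtrees[OF assms]] finite_subset by blast
qed

lemma graded_dual_iso:
  assumes "finite \<Omega>"
  shows "bij_betw (\<lambda>f. restrict (pairing f) (T_space \<Omega>)) (T_dual \<Omega>)
           (graded_dual \<Omega> :: (('a forest \<Rightarrow>\<^sub>0 'k::field) \<Rightarrow> 'k) set)"
proof -
  let ?T = "T_space \<Omega> :: ('a forest \<Rightarrow>\<^sub>0 'k) set"
  have sT: "Poly_Mapping.single b 1 \<in> ?T" if "b \<in> trees \<Omega>" for b
    using that by (simp add: free_on_def)
  have addT: "x + y \<in> ?T" if "x \<in> ?T" "y \<in> ?T" for x y
    using that Poly_Mapping.keys_add[of x y] by (auto simp: free_on_def)
  have sclT: "scale c x \<in> ?T" if "x \<in> ?T" for c x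
    using that by (auto simp: free_on_def in_keys_iff)
  have lin: "linear_on ?T (*) (restrict \<phi> ?T)" if "linear_on ?T (*) \<phi>" for \<phi>
    using that addT sclT by (auto simp: linear_on_def)
  show ?thesis
    unfolding bij_betw_def T_dual_def
  proof (intro conjI inj_onI equalityI subsetI)
    fix f g
    assume f: "f \<in> ?T" and g: "g \<in> ?T"
      and eq: "restrict (pairing f) ?T = restrict (pairing g) ?T"
    show "f = g"
    proof (rule poly_mapping_eqI)
      fix b
      show "Poly_Mapping.lookup f b = Poly_Mapping.lookup g b"
      proof (cases "b \<in> trees \<Omega>")
        case True
        then show ?thesis
          using fun_cong[OF eq, of "Poly_Mapping.single b 1"] sT by (simp add: pairing_single_right)
      next
        case False
        then have "b \<notin> Poly_Mapping.keys f" "b \<notin> Poly_Mapping.keys g"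
          using f g by (auto simp: free_on_def)
        then show ?thesis by (simp add: in_keys_iff)
      qed
    qed
  next
    fix \<phi> assume "\<phi> \<in> (\<lambda>f. restrict (pairing f) ?T) ` ?T"
    then obtain f where f: "f \<in> ?T" and \<phi>: "\<phi> = restrict (pairing f) ?T" by blast
    have "{n. \<exists>x\<in>free_on {F \<in> trees \<Omega>. forest_vertices F = n}. \<phi> x \<noteq> 0} \<subseteq>
        forest_vertices ` Poly_Mapping.keys f"
    proof
      fix n assume "n \<in> {n. \<exists>x\<in>free_on {F \<in> trees \<Omega>. forest_vertices F = n}. \<phi> x \<noteq> 0}"
      then obtain x where x: "Poly_Mapping.keys x \<subseteq> {F \<in> trees \<Omega>. forest_vertices F = n}"
        and nz: "\<phi> x \<noteq> 0"
        by (auto simp: free_on_def)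
      then have "x \<in> ?T" by (auto simp: free_on_def)
      then have "pairing f x \<noteq> 0" using nz \<phi> by simp
      then obtain b where "b \<in> Poly_Mapping.keys f" "Poly_Mapping.lookup x b \<noteq> 0"
        unfolding pairing_def by (metis (no_types, lifting) mult_zero_right sum.neutral)
      then show "n \<in> forest_vertices ` Poly_Mapping.keys f" using x by (auto simp: in_keys_iff)
    qed
    then have "finite {n. \<exists>x\<in>free_on {F \<in> trees \<Omega>. forest_vertices F = n}. \<phi> x \<noteq> 0}"
      by (rule finite_subset) simp
    moreover have "linear_on ?T (*) \<phi>"
      unfolding \<phi> by (rule lin[OF linear_on_pairing])
    moreover have "\<phi> \<in> extensional ?T" unfolding \<phi> by (rule restrict_extensional)
    ultimately show "\<phi> \<in> graded_dual \<Omega>" unfolding graded_dual_def by blast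
  next
    fix \<phi> :: "('a forest \<Rightarrow>\<^sub>0 'k) \<Rightarrow> 'k" assume \<phi>: "\<phi> \<in> graded_dual \<Omega>"
    define N where "N = {n. \<exists>x\<in>free_on {F \<in> trees \<Omega>. forest_vertices F = n}. \<phi> x \<noteq> 0}"
    define h where "h F = (if F \<in> trees \<Omega> then \<phi> (Poly_Mapping.single F 1) else 0)" for F
    have "{F. h F \<noteq> 0} \<subseteq> (\<Union>n\<in>N. {F \<in> trees \<Omega>. forest_vertices F = n})"
    proof
      fix F assume "F \<in> {F. h F \<noteq> 0}"
      then have F: "F \<in> trees \<Omega>" "\<phi> (Poly_Mapping.single F 1) \<noteq> 0"
        by (auto simp: h_def split: if_splits)
      then have "Poly_Mapping.single F 1 \<in>
          (free_on {G \<in> trees \<Omega>. forest_vertices G = forest_vertices F} :: ('a forest \<Rightarrow>\<^sub>0 'k) set)"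
        by (simp add: free_on_def)
      then have "forest_vertices F \<in> N" using F N_def by blast
      then show "F \<in> (\<Union>n\<in>N. {F \<in> trees \<Omega>. forest_vertices F = n})" using F by auto
    qed
    moreover have "finite N" using \<phi> by (simp add: graded_dual_def N_def)
    ultimately have fin: "finite {F. h F \<noteq> 0}"
      using finite_trees_of_size[OF assms] by (meson finite_UN_I finite_subset)
    define f where "f = Abs_poly_mapping h"
    have lf: "Poly_Mapping.lookup f = h" using fin by (simp add: f_def)
    have fT: "f \<in> ?T"
      unfolding free_on_def by (auto simp: in_keys_iff lf h_def split: if_splits)
    have "restrict (pairing f) ?T = \<phi>"
    proof
      fix x
      show "restrict (pairing f) ?T x = \<phi> x"
      proof (cases "x \<in> ?T")
        case True
        have "pairing f x = \<phi> x"
          by (rule linear_on_free_on_eqI[OF linear_on_pairing _ _ True])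
             (use \<phi> in \<open>auto simp: graded_dual_def pairing_single_right lf h_def\<close>)
        then show ?thesis using True by simp
      next
        case False
        then show ?thesis using \<phi> by (auto simp: graded_dual_def extensional_def)
      qed
    qed
    then show "\<phi> \<in> (\<lambda>f. restrict (pairing f) ?T) ` ?T" using fT by blast
  qed
qed

text \<open>
  Grafting of (the root of) the tree \<open>G\<close> on every leaf. It is only used when there is just one leaf
  \<open>l\<close>, and is then grafting at \<open>l\<close>; grafting \<open>\<emptyset>\<close> does not change anything.
\<close>

primrec graft_leaf :: "'a rtree \<Rightarrow> 'a forest \<Rightarrow> 'a rtree" where
  "graft_leaf (B_plus a f) G =
     B_plus a (if f = {#} then G else image_mset (\<lambda>T. graft_leaf T G) f)"

text \<open>Here too the arguments are meant to be trees.\<close>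

definition dual_prod_basis :: "'a forest \<Rightarrow> 'a forest \<Rightarrow> ('a forest \<Rightarrow>\<^sub>0 'k::field)" where
  "dual_prod_basis F G =
     (if F = {#} then Poly_Mapping.single G 1
      else if forest_leaves F > 1 then 0
      else Poly_Mapping.single (image_mset (\<lambda>T. graft_leaf T G) F) 1)"

definition dual_prod ::
  "('a forest \<Rightarrow>\<^sub>0 'k::field) \<Rightarrow> ('a forest \<Rightarrow>\<^sub>0 'k) \<Rightarrow> ('a forest \<Rightarrow>\<^sub>0 'k)" (infixl \<open>\<unlhd>\<close> 70) where
  "(\<unlhd>) = bilin_ext dual_prod_basis"

definition Delta_star ::
  "'a set \<Rightarrow> ('a forest \<Rightarrow>\<^sub>0 'k::field) \<Rightarrow> ('a forest \<times> 'a forest \<Rightarrow>\<^sub>0 'k)" where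
  "Delta_star \<Omega> f = (THE t. t \<in> free_on (trees \<Omega> \<times> trees \<Omega>) \<and>
     (\<forall>a\<in>T_space \<Omega>. \<forall>b\<in>T_space \<Omega>. pairing t (tensor a b) = pairing f (shuffle a b)))"

end

theory Submission
  imports Defs
begin

text \<open>
  The compatibility axiom of a bialgebra is self-dual: the transpose of the map
  \<open>(m \<otimes> m) \<circ> \<tau>\<^sub>2\<^sub>3 \<circ> (D \<otimes> D)\<close> has the same shape, with the transpose of \<open>m\<close> as coproduct and that
  of \<open>D\<close> as product. So it suffices to know three things: \<open>\<unlhd>\<close> is adjoint to \<open>\<Delta>\<close>
  (\<open>adjoint_dual_prod_Delta\<close>), \<open>\<Delta>\<^sup>*\<close> exists and is adjoint to the shuffle product
  (\<open>adjoint_Delta_star_shuffle\<close>), and \<open>\<Delta>\<close> is multiplicative for the shuffle product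
  (\<open>Delta_on_tensor_shuffle\<close>). Since a map is determined by its adjoint, the compatibility of \<open>\<unlhd>\<close>
  and \<open>\<Delta>\<^sup>*\<close> follows.

  The key to multiplicativity is that \<open>\<Delta>\<close> is extended by \<open>0\<close> to disconnected forests. Then
  \<open>\<Delta>(B\<^sub>+\<^sup>a(x)) = (B\<^sub>+\<^sup>a \<otimes> Id)(\<Delta>(x)) + \<emptyset> \<otimes> B\<^sub>+\<^sup>a(x)\<close> for every combination \<open>x\<close> of forests, without a
  case distinction, and \<open>\<Delta>(F \<squnion> G) = \<Delta>(F) \<squnion> \<Delta>(G)\<close> (with \<open>\<squnion>\<close> for the shuffle product) can be proved
  for all forests by induction along the recursion of the shuffle product. If one of two non-empty
  forests is disconnected, then so is every forest in their shuffle product, and both sides vanish,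
  whatever the value of the coefficient \<open>1/(kn)\<close> in the field. For two non-empty trees the
  recursions of \<open>\<Delta>\<close> and of the shuffle product match term by term.

  The adjointness of \<open>\<unlhd>\<close> and \<open>\<Delta>\<close> is an induction too, because \<open>\<unlhd>\<close> satisfies
  \<open>B\<^sub>+\<^sup>a(f) \<unlhd> G = B\<^sub>+\<^sup>a(f \<unlhd> G)\<close>, where \<open>f \<unlhd> G\<close> is \<open>0\<close> for a disconnected forest \<open>f\<close>. Finally, \<open>\<Delta>\<^sup>*\<close>
  exists because the shuffle product is graded by the number of vertices and there are finitely
  many trees of each degree. Its counit is the coefficient of \<open>\<emptyset>\<close>, because \<open>\<emptyset>\<close> is the unit of the
  shuffle product.
\<close>

section \<open>Linear maps between free vector spaces\<close>

abbreviation basis :: "'b \<Rightarrow> ('b \<Rightarrow>\<^sub>0 'k::field)" where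
  "basis b \<equiv> Poly_Mapping.single b 1"

(* The empty forest is the zero of the monoid of forests, so this rule would turn its basis vector
   into the unit of the algebra of forests. *)
declare single_one [simp del]

abbreviation linear_map :: "(('b \<Rightarrow>\<^sub>0 'k::field) \<Rightarrow> ('c \<Rightarrow>\<^sub>0 'k)) \<Rightarrow> bool" where
  "linear_map f \<equiv> linear_on UNIV scale f"

lemma scale_add [simp]: "scale c (x + y) = scale c x + scale c y"
  by (rule poly_mapping_eqI) (simp add: lookup_add distrib_left)

lemma scale_scale [simp]: "scale c (scale d x) = scale (c * d) x"
  by (rule poly_mapping_eqI) simp

lemma scale_add_left: "scale (c + d) x = scale c x + scale d x"
  by (rule poly_mapping_eqI) (simp add: lookup_add distrib_right)

lemma scale_0 [simp]: "scale c 0 = 0" "scale 0 x = 0"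
  by (rule poly_mapping_eqI, simp)+

lemma scale_1 [simp]: "scale 1 x = x"
  by (rule poly_mapping_eqI) simp

lemma scale_sum: "scale c (sum f A) = (\<Sum>a\<in>A. scale c (f a))"
  by (induction A rule: infinite_finite_induct) simp_all

lemma lookup_basis: "Poly_Mapping.lookup (basis b) c = (if b = c then 1 else 0)"
  by (simp add: lookup_single when_def)

lemma linear_mapI:
  "(\<And>x y. f (x + y) = f x + f y) \<Longrightarrow> (\<And>c x. f (scale c x) = scale c (f x)) \<Longrightarrow> linear_map f"
  by (simp add: linear_on_def)

lemma linear_map_add: "linear_map f \<Longrightarrow> f (x + y) = f x + f y"
  and linear_map_scale: "linear_map f \<Longrightarrow> f (scale c x) = scale c (f x)"
  by (simp_all add: linear_on_def)

lemma free_on_closed: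
  "0 \<in> free_on X"
  "b \<in> X \<Longrightarrow> basis b \<in> free_on X"
  "x \<in> free_on X \<Longrightarrow> y \<in> free_on X \<Longrightarrow> x + y \<in> free_on X"
  "x \<in> free_on X \<Longrightarrow> scale c x \<in> free_on X"
  using Poly_Mapping.keys_add[of x y] by (auto simp: free_on_def in_keys_iff)

lemma free_on_UNIV [simp]: "x \<in> free_on UNIV"
  by (simp add: free_on_def)

lemma free_on_mono: "X \<subseteq> Y \<Longrightarrow> x \<in> free_on X \<Longrightarrow> x \<in> free_on Y"
  by (auto simp: free_on_def)

lemma free_on_lookup_eq_0: "x \<in> free_on X \<Longrightarrow> b \<notin> X \<Longrightarrow> Poly_Mapping.lookup x b = 0"
  by (auto simp: free_on_def in_keys_iff)

lemma free_on_induct [consumes 1, case_names zero basis scale add]: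
  assumes x: "x \<in> free_on X"
    and z: "P 0" and b: "\<And>b. b \<in> X \<Longrightarrow> P (basis b)"
    and s: "\<And>c x. P x \<Longrightarrow> P (scale c x)"
    and a: "\<And>x y. P x \<Longrightarrow> P y \<Longrightarrow> P (x + y)"
  shows "P x"
proof -
  have "P (\<Sum>b\<in>A. scale (Poly_Mapping.lookup x b) (basis b))"
    if "finite A" "A \<subseteq> Poly_Mapping.keys x" for A
    using that
  proof (induction A)
    case (insert b A)
    have "b \<in> X" using insert.prems x by (auto simp: free_on_def)
    then have "P (scale (Poly_Mapping.lookup x b) (basis b))" using s b by blast
    then show ?case using insert a by simp
  qed (simp add: z)
  moreover have "(\<Sum>b\<in>Poly_Mapping.keys x. scale (Poly_Mapping.lookup x b) (basis b)) = x"
    by (rule poly_mapping_eqI) (simp add: lookup_sum lookup_basis if_distrib in_keys_iff cong: if_cong)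
  ultimately show ?thesis by (metis finite_keys order_refl)
qed

lemma linear_map_0: "linear_map f \<Longrightarrow> f 0 = 0"
  by (metis linear_map_scale scale_0(2))

lemma linear_map_eqI:
  assumes "linear_map f" "linear_map g" "x \<in> free_on X"
    and "\<And>b. b \<in> X \<Longrightarrow> f (basis b) = g (basis b)"
  shows "f x = g x"
  using assms(3)
  by (induction rule: free_on_induct)
     (simp_all add: assms(4) linear_map_0[OF assms(1)] linear_map_0[OF assms(2)]
        linear_map_add[OF assms(1)] linear_map_add[OF assms(2)]
        linear_map_scale[OF assms(1)] linear_map_scale[OF assms(2)])

text \<open>
  The conclusion is not a higher-order pattern, so this rule is applied with \<open>f\<close>, \<open>g\<close>, \<open>x\<close> and \<open>y\<close>
  given explicitly.
\<close>

lemma bilinear_map_eqI: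
  assumes "\<And>y. linear_map (\<lambda>x. f x y)" "\<And>x. linear_map (f x)"
    and "\<And>y. linear_map (\<lambda>x. g x y)" "\<And>x. linear_map (g x)"
    and "\<And>b c. f (basis b) (basis c) = g (basis b) (basis c)"
  shows "f x y = g x y"
proof -
  have "f (basis b) y = g (basis b) y" for b
    using assms(2)[of "basis b"] assms(4)[of "basis b"] free_on_UNIV[of y]
    by (rule linear_map_eqI) (rule assms(5))
  with assms(1)[of y] assms(3)[of y] free_on_UNIV[of x] show ?thesis
    by (rule linear_map_eqI[where f = "\<lambda>x. f x y" and g = "\<lambda>x. g x y"])
qed

lemma linear_map_in_free_on:
  assumes "linear_map f" "x \<in> free_on X" "\<And>b. b \<in> X \<Longrightarrow> f (basis b) \<in> free_on Y"
  shows "f x \<in> free_on Y"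
  using assms(2)
  by (induction rule: free_on_induct)
     (simp_all add: assms(3) linear_map_0[OF assms(1)] linear_map_add[OF assms(1)]
        linear_map_scale[OF assms(1)] free_on_closed)

text \<open>
  A common finite index set is needed to compare the values of \<open>lin_ext g\<close> at vectors with
  different supports.
\<close>

lemma lin_ext_superset:
  assumes "finite A" "Poly_Mapping.keys x \<subseteq> A"
  shows "lin_ext g x = (\<Sum>b\<in>A. scale (Poly_Mapping.lookup x b) (g b))"
  unfolding lin_ext_def using assms by (intro sum.mono_neutral_left) (auto simp: in_keys_iff)

lemma lin_ext_add [simp]: "lin_ext g (x + y) = lin_ext g x + lin_ext g y"
proof -
  let ?A = "Poly_Mapping.keys x \<union> Poly_Mapping.keys y"
  have "lin_ext g z = (\<Sum>b\<in>?A. scale (Poly_Mapping.lookup z b) (g b))"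
    if "Poly_Mapping.keys z \<subseteq> ?A" for z
    using that by (intro lin_ext_superset) simp_all
  then show ?thesis
    using Poly_Mapping.keys_add[of x y]
    by (simp add: lookup_add scale_add_left sum.distrib)
qed

lemma lin_ext_scale [simp]: "lin_ext g (scale c x) = scale c (lin_ext g x)"
proof -
  have "lin_ext g (scale c x) = (\<Sum>b\<in>Poly_Mapping.keys x. scale (c * Poly_Mapping.lookup x b) (g b))"
    using lin_ext_superset[of "Poly_Mapping.keys x" "scale c x" g]
    by (simp add: subset_iff in_keys_iff)
  then show ?thesis by (simp add: lin_ext_def scale_sum)
qed

lemma lin_ext_basis [simp]: "lin_ext g (basis b) = g b"
  by (simp add: lin_ext_def)

lemma lin_ext_0 [simp]: "lin_ext g 0 = 0"
  by (simp add: lin_ext_def)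

lemma lin_ext_fun_add: "lin_ext (\<lambda>b. g b + h b) x = lin_ext g x + lin_ext h x"
  by (simp add: lin_ext_def sum.distrib)

lemma lin_ext_fun_scale: "lin_ext (\<lambda>b. scale c (g b)) x = scale c (lin_ext g x)"
  by (simp add: lin_ext_def scale_sum mult.commute)

lemma bilin_ext_simps [simp]:
  "bilin_ext g (x + x') y = bilin_ext g x y + bilin_ext g x' y"
  "bilin_ext g x (y + y') = bilin_ext g x y + bilin_ext g x y'"
  "bilin_ext g (scale c x) y = scale c (bilin_ext g x y)"
  "bilin_ext g x (scale c y) = scale c (bilin_ext g x y)"
  "bilin_ext g 0 y = 0"
  "bilin_ext g x 0 = 0"
  "bilin_ext g (basis b) (basis b') = g b b'"
  by (simp_all add: bilin_ext_def lin_ext_fun_add lin_ext_fun_scale)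
     (simp add: lin_ext_def)

lemma tensor_simps [simp]:
  "tensor (x + x') y = tensor x y + tensor x' y"
  "tensor x (y + y') = tensor x y + tensor x y'"
  "tensor (scale c x) y = scale c (tensor x y)"
  "tensor x (scale c y) = scale c (tensor x y)"
  "tensor 0 y = 0"
  "tensor x 0 = 0"
  "tensor (basis b) (basis b') = basis (b, b')"
  by (simp_all add: tensor_def)

lemma lookup_tensor [simp]:
  fixes x :: "'b \<Rightarrow>\<^sub>0 'k::field"
  shows "Poly_Mapping.lookup (tensor x y) (b, c) = Poly_Mapping.lookup x b * Poly_Mapping.lookup y c"
proof -
  have 1: "Poly_Mapping.lookup (tensor (basis b') y) (b, c) =
      Poly_Mapping.lookup (basis b' :: 'b \<Rightarrow>\<^sub>0 'k) b * Poly_Mapping.lookup y c" for b'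
    using free_on_UNIV[of y]
    by (induction y rule: free_on_induct) (simp_all add: lookup_basis lookup_add distrib_left)
  show ?thesis
    using free_on_UNIV[of x]
    by (induction x rule: free_on_induct) (simp_all add: 1 lookup_add distrib_right mult.assoc)
qed

lemma tensor_in_free_on:
  "x \<in> free_on X \<Longrightarrow> y \<in> free_on Y \<Longrightarrow> tensor x y \<in> free_on (X \<times> Y)"
  by (auto simp: free_on_def in_keys_iff subset_iff)

lemma tensor_map_simps [simp]:
  "tensor_map f g (x + y) = tensor_map f g x + tensor_map f g y"
  "tensor_map f g (scale c x) = scale c (tensor_map f g x)"
  "tensor_map f g 0 = 0"
  "tensor_map f g (basis (b, d)) = tensor (f (basis b)) (g (basis d))"
  by (simp_all add: tensor_map_def)

lemma tensor_map_tensor: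
  assumes "linear_map f" "linear_map g"
  shows "tensor_map f g (tensor x y) = tensor (f x) (g y)"
  by (rule bilinear_map_eqI[where f = "\<lambda>x y. tensor_map f g (tensor x y)"
        and g = "\<lambda>x y. tensor (f x) (g y)" and x = x and y = y])
     (simp_all add: linear_on_def linear_map_add[OF assms(1)] linear_map_add[OF assms(2)]
        linear_map_scale[OF assms(1)] linear_map_scale[OF assms(2)])

lemma on_tensor_simps [simp]:
  "on_tensor m (x + y) = on_tensor m x + on_tensor m y"
  "on_tensor m (scale c x) = scale c (on_tensor m x)"
  "on_tensor m 0 = 0"
  "on_tensor m (basis (b, d)) = m (basis b) (basis d)"
  by (simp_all add: on_tensor_def)

lemma on_tensor_bilin_ext: "on_tensor (bilin_ext g) (tensor x y) = bilin_ext g x y"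
  by (rule bilinear_map_eqI[where f = "\<lambda>x y. on_tensor (bilin_ext g) (tensor x y)"
        and g = "\<lambda>x y. bilin_ext g x y" and x = x and y = y]) (simp_all add: linear_on_def)

lemma tau23_simps [simp]:
  "tau23 (x + y) = tau23 x + tau23 y"
  "tau23 (scale c x) = scale c (tau23 x)"
  "tau23 0 = 0"
  "tau23 (basis ((p, q), (r, s))) = basis ((p, r), (q, s))"
  by (simp_all add: tau23_def)


section \<open>Adjoint maps\<close>

lemma pairing_superset:
  assumes "finite A" "Poly_Mapping.keys f \<subseteq> A"
  shows "pairing f x = (\<Sum>b\<in>A. Poly_Mapping.lookup f b * Poly_Mapping.lookup x b)"
  unfolding pairing_def using assms by (intro sum.mono_neutral_left) (auto simp: in_keys_iff)

lemma pairing_commute: "pairing f x = pairing x f"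
proof -
  let ?A = "Poly_Mapping.keys f \<union> Poly_Mapping.keys x"
  show ?thesis
    by (simp add: pairing_superset[of ?A f x] pairing_superset[of ?A x f] mult.commute)
qed

lemma pairing_simps [simp]:
  "pairing f (x + y) = pairing f x + pairing f y"
  "pairing f (scale c x) = c * pairing f x"
  "pairing f 0 = 0"
  using linear_on_pairing[of UNIV f] by (auto simp: linear_on_def pairing_def)

lemma pairing_simps_left [simp]:
  "pairing (f + g) x = pairing f x + pairing g x"
  "pairing (scale c f) x = c * pairing f x"
  "pairing 0 x = 0"
  by (simp_all add: pairing_commute[of _ x])

lemma pairing_basis: "pairing (basis b) x = Poly_Mapping.lookup x b"
  by (subst pairing_commute) (rule pairing_single_right)

text \<open>
  By \<open>pairing\<close>, a free space is identified with the span of the dual basis in its dual space;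
  duality of maps then becomes adjointness.
\<close>

definition adjoint_on ::
  "'b set \<Rightarrow> 'c set \<Rightarrow> (('b \<Rightarrow>\<^sub>0 'k::field) \<Rightarrow> ('c \<Rightarrow>\<^sub>0 'k)) \<Rightarrow> (('c \<Rightarrow>\<^sub>0 'k) \<Rightarrow> ('b \<Rightarrow>\<^sub>0 'k)) \<Rightarrow> bool" where
  "adjoint_on X Y f g \<longleftrightarrow> (\<forall>x\<in>free_on X. \<forall>y\<in>free_on Y. pairing (f x) y = pairing x (g y))"

text \<open>
  By bilinearity of the pairing, adjointness need only be checked on basis elements, where it says
  that the matrices are transposes of each other.
\<close>

lemma adjoint_onI:
  assumes f: "linear_map f" and g: "linear_map g"
    and eq: "\<And>b c. b \<in> X \<Longrightarrow> c \<in> Y \<Longrightarrow>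
      Poly_Mapping.lookup (f (basis b)) c = Poly_Mapping.lookup (g (basis c)) b"
  shows "adjoint_on X Y f g"
proof -
  note lin = linear_map_0[OF f] linear_map_0[OF g] linear_map_add[OF f] linear_map_add[OF g]
    linear_map_scale[OF f] linear_map_scale[OF g]
  have 1: "pairing (f (basis b)) y = pairing (basis b) (g y)" if "b \<in> X" "y \<in> free_on Y" for b y
    using that(2)
    by (induction rule: free_on_induct)
       (simp_all add: lin pairing_single_right pairing_basis eq that(1))
  have "pairing (f x) y = pairing x (g y)" if "x \<in> free_on X" "y \<in> free_on Y" for x y
    using that(1) by (induction rule: free_on_induct) (simp_all add: lin 1 that(2))
  then show ?thesis by (simp add: adjoint_on_def)
qed

lemma adjoint_on_lookup:
  assumes "adjoint_on X Y f g" "b \<in> X" "c \<in> Y"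
  shows "Poly_Mapping.lookup (f (basis b)) c = Poly_Mapping.lookup (g (basis c)) b"
proof -
  have "pairing (f (basis b)) (basis c) = pairing (basis b) (g (basis c))"
    using assms by (simp add: adjoint_on_def free_on_closed)
  then show ?thesis by (simp add: pairing_single_right pairing_basis)
qed

lemma adjoint_on_compose:
  assumes "adjoint_on X Y f f'" "adjoint_on Y Z g g'"
    and "\<And>x. x \<in> free_on X \<Longrightarrow> f x \<in> free_on Y"
    and "\<And>z. z \<in> free_on Z \<Longrightarrow> g' z \<in> free_on Y"
  shows "adjoint_on X Z (\<lambda>x. g (f x)) (\<lambda>z. f' (g' z))"
  using assms by (simp add: adjoint_on_def)

lemma adjoint_on_tensor_map:
  assumes "adjoint_on X Y f f'" "adjoint_on X2 Y2 g g'"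
  shows "adjoint_on (X \<times> X2) (Y \<times> Y2) (tensor_map f g) (tensor_map f' g')"
  by (rule adjoint_onI)
     (auto simp: linear_on_def adjoint_on_lookup[OF assms(1)] adjoint_on_lookup[OF assms(2)])

lemma adjoint_on_tau23:
  "adjoint_on ((A \<times> B) \<times> (C \<times> D)) ((A \<times> C) \<times> (B \<times> D)) tau23 tau23"
  by (rule adjoint_onI) (auto simp: linear_on_def lookup_basis)

text \<open>Basis elements separate vectors, so a map is determined by any adjoint of it.\<close>

lemma adjoint_on_unique:
  assumes "adjoint_on X Y f f'" "adjoint_on X Y g g'"
    and eq: "\<And>y. y \<in> free_on Y \<Longrightarrow> f' y = g' y"
    and Y: "f x \<in> free_on Y" "g x \<in> free_on Y" and x: "x \<in> free_on X"
  shows "f x = g x"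
proof (rule poly_mapping_eqI)
  fix c
  show "Poly_Mapping.lookup (f x) c = Poly_Mapping.lookup (g x) c"
  proof (cases "c \<in> Y")
    case True
    then have c: "basis c \<in> free_on Y" by (rule free_on_closed)
    have "pairing (f x) (basis c) = pairing (g x) (basis c)"
      using assms(1,2) x c eq by (metis adjoint_on_def)
    then show ?thesis by (simp add: pairing_single_right)
  qed (simp add: free_on_lookup_eq_0[OF Y(1)] free_on_lookup_eq_0[OF Y(2)])
qed

lemma tensor_map_in_free_on:
  assumes "\<And>x. x \<in> free_on X \<Longrightarrow> f x \<in> free_on Y" "\<And>x. x \<in> free_on X2 \<Longrightarrow> g x \<in> free_on Y2"
    and "z \<in> free_on (X \<times> X2)"
  shows "tensor_map f g z \<in> free_on (Y \<times> Y2)"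
  by (rule linear_map_in_free_on[OF _ assms(3), where f = "tensor_map f g"])
     (auto simp: linear_on_def assms free_on_closed intro!: tensor_in_free_on)

lemma tau23_in_free_on:
  assumes "z \<in> free_on ((A \<times> B) \<times> (C \<times> D))"
  shows "tau23 z \<in> free_on ((A \<times> C) \<times> (B \<times> D))"
  by (rule linear_map_in_free_on[OF _ assms, where f = "tau23"]) (auto simp: linear_on_def free_on_closed)


section \<open>Grading and decorations of the shuffle product\<close>

lemma B_plus_lin_simps [simp]:
  "B_plus_lin a (x + y) = B_plus_lin a x + B_plus_lin a y"
  "B_plus_lin a (scale c x) = scale c (B_plus_lin a x)"
  "B_plus_lin a 0 = 0"
  "B_plus_lin a (basis f) = basis {#B_plus a f#}"
  by (simp_all add: B_plus_lin_def)

lemma linear_map_B_plus_lin: "linear_map (B_plus_lin a)"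
  by (simp add: linear_on_def)

lemma lookup_B_plus_lin:
  "Poly_Mapping.lookup (B_plus_lin a x) {#B_plus b f#} =
     (if a = b then Poly_Mapping.lookup x f else 0)"
  "\<nexists>f. H = {#B_plus a f#} \<Longrightarrow> Poly_Mapping.lookup (B_plus_lin a x) H = 0"
  using free_on_UNIV[of x]
  by (induction x rule: free_on_induct) (auto simp: lookup_basis lookup_add)

lemma keys_B_plus_lin:
  "Poly_Mapping.keys (B_plus_lin a x) = (\<lambda>f. {#B_plus a f#}) ` Poly_Mapping.keys x"
proof (intro equalityI subsetI)
  fix H assume "H \<in> Poly_Mapping.keys (B_plus_lin a x)"
  then have nz: "Poly_Mapping.lookup (B_plus_lin a x) H \<noteq> 0" by (simp add: in_keys_iff)
  then obtain f where "H = {#B_plus a f#}" using lookup_B_plus_lin(2) by metis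
  then show "H \<in> (\<lambda>f. {#B_plus a f#}) ` Poly_Mapping.keys x"
    using nz by (auto simp: lookup_B_plus_lin in_keys_iff)
qed (auto simp: in_keys_iff lookup_B_plus_lin)

definition decorations :: "'a forest \<Rightarrow> 'a set" where
  "decorations F = (\<Union>T\<in>set_mset F. set_rtree T)"

lemma decorations_simps [simp]:
  "decorations {#} = {}"
  "decorations {#B_plus a f#} = insert a (decorations f)"
  "decorations (F + G) = decorations F \<union> decorations G"
  by (auto simp: decorations_def)

lemma trees_iff: "F \<in> trees \<Omega> \<longleftrightarrow> size F \<le> 1 \<and> decorations F \<subseteq> \<Omega>"
  by (auto simp: trees_def decorations_def)

lemma forest_vertices_add: "forest_vertices (F + G) = forest_vertices F + forest_vertices G"
  by (simp add: forest_vertices_def)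

lemma sum_mset_in_free_on:
  "(\<And>T. T \<in># F \<Longrightarrow> f T \<in> free_on X) \<Longrightarrow> (\<Sum>T\<in>#F. f T) \<in> free_on X"
  by (induction F) (auto intro: free_on_closed)

lemma mult_basis_in_free_on:
  "x \<in> free_on X \<Longrightarrow> (\<And>F. F \<in> X \<Longrightarrow> F + G \<in> Y) \<Longrightarrow> x * basis G \<in> free_on Y"
  using keys_mult[of x "basis G"] by (fastforce simp: free_on_def)

lemma B_plus_lin_in_free_on:
  "x \<in> free_on X \<Longrightarrow> (\<And>f. f \<in> X \<Longrightarrow> {#B_plus a f#} \<in> Y) \<Longrightarrow> B_plus_lin a x \<in> free_on Y"
  by (auto simp: free_on_def keys_B_plus_lin)

text \<open>
  The recursion of the shuffle product only moves vertices around, so it keeps their number and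
  their decorations. The grading makes \<open>\<Delta>\<^sup>*\<close> well defined; the decorations keep everything over
  \<open>\<Omega>\<close>.
\<close>

lemma shuffle_basis_graded:
  "(shuffle_basis F G :: 'a forest \<Rightarrow>\<^sub>0 'k::field) \<in>
     free_on {H. forest_vertices H = forest_vertices F + forest_vertices G \<and>
                 decorations H \<subseteq> decorations F \<union> decorations G}"
proof (induction F G rule: shuffle_basis.induct)
  case (3 a f a' f')
  show ?case
    unfolding shuffle_basis.simps
    by (intro free_on_closed B_plus_lin_in_free_on[OF 3(1)] B_plus_lin_in_free_on[OF 3(2)]) auto
next
  case (4 F F')
  show ?case
    unfolding shuffle_basis.simps(4)[OF 4(1-3)]
  proof (intro free_on_closed sum_mset_in_free_on)
    fix T t assume T: "T \<in># F" and t: "t \<in># F'"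
    obtain R where R: "F = add_mset T R" using T by (meson mset_add)
    obtain r where r: "F' = add_mset t r" using t by (meson mset_add)
    have R': "decorations F = decorations {#T#} \<union> decorations R"
      "decorations F' = decorations {#t#} \<union> decorations r"
      unfolding R r decorations_simps(3)[symmetric] by simp_all
    show "(shuffle_basis {#T#} {#t#} :: 'a forest \<Rightarrow>\<^sub>0 'k) * basis (F - {#T#} + (F' - {#t#})) \<in>
        free_on {H. forest_vertices H = forest_vertices F + forest_vertices F' \<and>
                    decorations H \<subseteq> decorations F \<union> decorations F'}"
      by (rule mult_basis_in_free_on[OF 4(4)[OF T t]])
         (use R' in \<open>auto simp: R r forest_vertices_add\<close>)
  qed
qed (auto intro!: free_on_closed)

lemma shuffle_basis_empty_left [simp]: "shuffle_basis {#} F = basis F"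
  by (cases "F = {#}") simp_all

lemma shuffle_basis_singletons:
  "shuffle_basis {#T#} {#t#} \<in> free_on {H. size H = 1}"
  by (cases T; cases t)
     (auto intro!: free_on_closed B_plus_lin_in_free_on[OF free_on_UNIV])

lemma shuffle_basis_trees:
  assumes "F \<in> trees \<Omega>" "G \<in> trees \<Omega>"
  shows "(shuffle_basis F G :: 'a forest \<Rightarrow>\<^sub>0 'k::field) \<in> free_on (trees \<Omega>)"
proof -
  have "shuffle_basis F G \<in> (free_on {H. size H \<le> 1} :: ('a forest \<Rightarrow>\<^sub>0 'k) set)"
  proof (cases "F = {#} \<or> G = {#}")
    case True
    then show ?thesis using assms by (auto simp: trees_iff intro!: free_on_closed)
  next
    case False
    then obtain T t where "F = {#T#}" "G = {#t#}"
      using assms by (metis trees_iff One_nat_def le_Suc_eq le_zero_eq size_1_singleton_mset size_eq_0_iff_empty)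
    then show ?thesis
      by (auto intro: free_on_mono[OF _ shuffle_basis_singletons])
  qed
  then show ?thesis
    using assms shuffle_basis_graded[of F G, where 'k = 'k] by (fastforce simp: free_on_def trees_iff)
qed

text \<open>
  Each summand of the shuffle product consists of a non-empty tree made from one component of \<open>F\<close>
  and one of \<open>G\<close>, and of the remaining components, of which there is at least one.
\<close>

lemma shuffle_basis_disconnected:
  assumes "F \<noteq> {#}" "G \<noteq> {#}" "size F + size G \<ge> 3"
  shows "(shuffle_basis F G :: 'a forest \<Rightarrow>\<^sub>0 'k::field) \<in> free_on {H. size H \<ge> 2}"
  unfolding shuffle_basis.simps(4)[OF assms]
proof (intro free_on_closed sum_mset_in_free_on)
  fix T t assume T: "T \<in># F" and t: "t \<in># G"
  have "size (F - {#T#} + (G - {#t#})) \<ge> 1"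
    using T t assms(3) by (simp add: size_Diff_singleton
        del: subset_mset.add_diff_assoc subset_mset.add_diff_assoc2)
  then show "(shuffle_basis {#T#} {#t#} :: 'a forest \<Rightarrow>\<^sub>0 'k) * basis (F - {#T#} + (G - {#t#})) \<in>
      free_on {H. size H \<ge> 2}"
    by (intro mult_basis_in_free_on[OF shuffle_basis_singletons]) simp
qed


section \<open>Multiplicativity of the coproduct\<close>

abbreviation B_plus_fst ::
  "'a \<Rightarrow> ('a forest \<times> 'a forest \<Rightarrow>\<^sub>0 'k::field) \<Rightarrow> ('a forest \<times> 'a forest \<Rightarrow>\<^sub>0 'k)" where
  "B_plus_fst a \<equiv> tensor_map (B_plus_lin a) (\<lambda>x. x)"

lemma Delta_simps [simp]:
  "Delta (x + y) = Delta x + Delta y"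
  "Delta (scale c x) = scale c (Delta x)"
  "Delta 0 = 0"
  "Delta (basis F) = Delta_basis F"
  by (simp_all add: Delta_def)

text \<open>
  The two recursion equations for trees merge into one, because \<open>\<Delta>\<close> is \<open>0\<close> on disconnected forests.
\<close>

lemma Delta_basis_B_plus:
  "Delta_basis {#B_plus a f#} = B_plus_fst a (Delta_basis f) + basis ({#}, {#B_plus a f#})"
  by (cases "size f \<le> 1") simp_all

lemma Delta_B_plus_lin:
  "Delta (B_plus_lin a x) = B_plus_fst a (Delta x) + tensor (basis {#}) (B_plus_lin a x)"
  using free_on_UNIV[of x]
  by (induction x rule: free_on_induct) (simp_all add: Delta_basis_B_plus)

lemma forest_cases [case_names empty tree disconnected]:
  assumes "F = {#} \<Longrightarrow> P" "\<And>a f. F = {#B_plus a f#} \<Longrightarrow> P" "size F \<ge> 2 \<Longrightarrow> P"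
  shows P
proof -
  consider "size F = 0" | "size F = 1" | "size F \<ge> 2" by linarith
  then show P
    by cases (use assms in \<open>auto simp: size_1_singleton_mset, metis One_nat_def size_1_singleton_mset rtree.exhaust\<close>)
qed

lemma shuffle_simps [simp]:
  "shuffle (x + x') y = shuffle x y + shuffle x' y"
  "shuffle x (y + y') = shuffle x y + shuffle x y'"
  "shuffle (scale c x) y = scale c (shuffle x y)"
  "shuffle x (scale c y) = scale c (shuffle x y)"
  "shuffle 0 y = 0"
  "shuffle x 0 = 0"
  "shuffle (basis F) (basis G) = shuffle_basis F G"
  by (simp_all add: shuffle_def)

text \<open>
  The componentwise shuffle product on the tensor square.
\<close>

definition tensor_shuffle ::
  "('a forest \<times> 'a forest \<Rightarrow>\<^sub>0 'k::field) \<Rightarrow> ('a forest \<times> 'a forest \<Rightarrow>\<^sub>0 'k) \<Rightarrow>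
   ('a forest \<times> 'a forest \<Rightarrow>\<^sub>0 'k)" where
  "tensor_shuffle u v = tensor_map (on_tensor shuffle) (on_tensor shuffle) (tau23 (tensor u v))"

lemma tensor_shuffle_simps [simp]:
  "tensor_shuffle (x + x') y = tensor_shuffle x y + tensor_shuffle x' y"
  "tensor_shuffle x (y + y') = tensor_shuffle x y + tensor_shuffle x y'"
  "tensor_shuffle (scale c x) y = scale c (tensor_shuffle x y)"
  "tensor_shuffle x (scale c y) = scale c (tensor_shuffle x y)"
  "tensor_shuffle 0 y = 0"
  "tensor_shuffle x 0 = 0"
  "tensor_shuffle (basis (F, G)) (basis (F', G')) = tensor (shuffle_basis F F') (shuffle_basis G G')"
  by (simp_all add: tensor_shuffle_def)

lemma B_plus_fst_tensor: "B_plus_fst a (tensor x y) = tensor (B_plus_lin a x) y"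
  by (rule tensor_map_tensor[OF linear_map_B_plus_lin]) (simp add: linear_on_def)

text \<open>
  This is the recursion of the shuffle product of two non-empty trees in the first tensor factor;
  the second factor is carried along.
\<close>

lemma tensor_shuffle_B_plus_fst:
  "tensor_shuffle (B_plus_fst a u) (B_plus_fst b v) =
     B_plus_fst a (tensor_shuffle u (B_plus_fst b v)) +
     B_plus_fst b (tensor_shuffle (B_plus_fst a u) v)"
  by (rule bilinear_map_eqI[where f = "\<lambda>x y. tensor_shuffle (B_plus_fst a x) (B_plus_fst b y)"
        and g = "\<lambda>x y. B_plus_fst a (tensor_shuffle x (B_plus_fst b y)) +
          B_plus_fst b (tensor_shuffle (B_plus_fst a x) y)" and x = u and y = v])
     (auto simp: linear_on_def B_plus_fst_tensor)

text \<open>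
  If one of the two first tensor factors is \<open>\<emptyset>\<close>, the product there is trivial, so that adding a
  root to the other one commutes with it.
\<close>

lemma tensor_shuffle_B_plus_fst_left:
  "tensor_shuffle (B_plus_fst a u) (tensor (basis {#}) y) =
     B_plus_fst a (tensor_shuffle u (tensor (basis {#}) y))"
  by (rule bilinear_map_eqI[where f = "\<lambda>x y. tensor_shuffle (B_plus_fst a x) (tensor (basis {#}) y)"
        and g = "\<lambda>x y. B_plus_fst a (tensor_shuffle x (tensor (basis {#}) y))"
        and x = u and y = y])
     (auto simp: linear_on_def B_plus_fst_tensor)

lemma tensor_shuffle_B_plus_fst_right:
  "tensor_shuffle (tensor (basis {#}) x) (B_plus_fst b v) =
     B_plus_fst b (tensor_shuffle (tensor (basis {#}) x) v)"
  by (rule bilinear_map_eqI[where f = "\<lambda>x y. tensor_shuffle (tensor (basis {#}) x) (B_plus_fst b y)"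
        and g = "\<lambda>x y. B_plus_fst b (tensor_shuffle (tensor (basis {#}) x) y)"
        and x = x and y = v])
     (auto simp: linear_on_def B_plus_fst_tensor)

lemma tensor_shuffle_unit:
  "tensor_shuffle u (basis ({#}, {#})) = u" "tensor_shuffle (basis ({#}, {#})) u = u"
  using free_on_UNIV[of u] by (induction u rule: free_on_induct) auto

lemma Delta_disconnected: "x \<in> free_on {H. size H \<ge> 2} \<Longrightarrow> Delta x = 0"
  by (induction x rule: free_on_induct) auto

text \<open>
  For two non-empty trees \<open>T = B\<^sub>+\<^sup>a(f)\<close> and \<open>T' = B\<^sub>+\<^sup>b(g)\<close>, both sides expand into the same four
  parts, according to whether the roots of \<open>T\<close> and \<open>T'\<close> go into the first or into the second tensor
  factor.
\<close>

lemma Delta_shuffle_basis: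
  "Delta (shuffle_basis F G :: 'a forest \<Rightarrow>\<^sub>0 'k::field) = tensor_shuffle (Delta_basis F) (Delta_basis G)"
proof (induction F G rule: shuffle_basis.induct)
  case (1 F)
  show ?case by (simp add: tensor_shuffle_unit)
next
  case (2 F)
  show ?case by (simp add: tensor_shuffle_unit)
next
  case (3 a f b g)
  let ?u = "Delta_basis f :: 'a forest \<times> 'a forest \<Rightarrow>\<^sub>0 'k"
    and ?v = "Delta_basis g :: 'a forest \<times> 'a forest \<Rightarrow>\<^sub>0 'k"
  let ?T = "{#B_plus a f#}" and ?T' = "{#B_plus b g#}"
  let ?e = "basis {#} :: 'a forest \<Rightarrow>\<^sub>0 'k"
  have T: "Delta_basis ?T = B_plus_fst a ?u + tensor ?e (basis ?T)"
    and T': "Delta_basis ?T' = B_plus_fst b ?v + tensor ?e (basis ?T')"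
    by (simp_all add: Delta_basis_B_plus)
  \<comment> \<open>The two terms \<open>\<emptyset> \<otimes> B\<^sub>+(\<dots>)\<close> add up to \<open>\<emptyset> \<otimes> (T \<squnion> T')\<close>.\<close>
  have "Delta (shuffle_basis ?T ?T') =
      B_plus_fst a (tensor_shuffle ?u (Delta_basis ?T')) +
      B_plus_fst b (tensor_shuffle (Delta_basis ?T) ?v) +
      tensor ?e (shuffle_basis ?T ?T')"
    by (simp only: shuffle_basis.simps Delta_simps Delta_B_plus_lin 3 tensor_simps ac_simps)
  also have "\<dots> = tensor_shuffle (B_plus_fst a ?u) (B_plus_fst b ?v) +
      tensor_shuffle (B_plus_fst a ?u) (tensor ?e (basis ?T')) +
      tensor_shuffle (tensor ?e (basis ?T)) (B_plus_fst b ?v) +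
      tensor_shuffle (tensor ?e (basis ?T)) (tensor ?e (basis ?T'))"
    unfolding T T' tensor_shuffle_simps(1,2) tensor_map_simps(1) tensor_shuffle_B_plus_fst
      tensor_shuffle_B_plus_fst_left tensor_shuffle_B_plus_fst_right
    by (simp only: tensor_simps(7) tensor_shuffle_simps(7) shuffle_basis.simps(1) ac_simps)
  also have "\<dots> = tensor_shuffle (Delta_basis ?T) (Delta_basis ?T')"
    unfolding T T' tensor_shuffle_simps by (simp only: ac_simps)
  finally show ?case .
next
  case (4 F F')
  \<comment> \<open>\<open>\<Delta>\<close> vanishes on the disconnected one of the two forests, and on their shuffle product.\<close>
  have "size F \<ge> 2 \<or> size F' \<ge> 2" using 4(3) by linarith
  then show ?case using Delta_disconnected[OF shuffle_basis_disconnected[OF 4(1-3)]] by auto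
qed

lemma Delta_on_tensor_shuffle:
  "Delta (on_tensor shuffle z) =
     tensor_map (on_tensor shuffle) (on_tensor shuffle) (tau23 (tensor_map Delta Delta z))"
  using free_on_UNIV[of z]
  by (induction z rule: free_on_induct) (auto simp: Delta_shuffle_basis tensor_shuffle_def)


section \<open>Duality between grafting at the leaf and the coproduct\<close>

lemma num_leaves_pos: "num_leaves T > 0"
proof (induction T)
  case (B_plus a f)
  then show ?case by (cases f) auto
qed

lemma forest_leaves_ge_size: "size F \<le> forest_leaves F"
proof (induction F)
  case (add T F)
  then show ?case using num_leaves_pos[of T] by (simp add: forest_leaves_def)
qed simp

text \<open>
  Every component contributes a leaf, so a disconnected forest has several leaves.
\<close>

lemma dual_prod_basis_disconnected: "size F \<ge> 2 \<Longrightarrow> dual_prod_basis F G = 0"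
  using forest_leaves_ge_size[of F] by (auto simp: dual_prod_basis_def)

text \<open>
  Apart from the case of a single vertex, a tree has the leaves of the forest below its root; if
  there is just one of them, grafting takes place in that forest, and otherwise both sides vanish.
  A single vertex is its own leaf, and \<open>G\<close> becomes the forest below it.
\<close>

lemma dual_prod_basis_B_plus:
  "dual_prod_basis {#B_plus a f#} G = B_plus_lin a (dual_prod_basis f G)"
  by (auto simp: dual_prod_basis_def forest_leaves_def)

lemma lookup_B_plus_fst:
  "Poly_Mapping.lookup (B_plus_fst a u) ({#B_plus b f#}, G) =
     (if a = b then Poly_Mapping.lookup u (f, G) else 0)"
  "\<nexists>f. F = {#B_plus a f#} \<Longrightarrow> Poly_Mapping.lookup (B_plus_fst a u) (F, G) = 0"
  using free_on_UNIV[of u]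
  by (induction u rule: free_on_induct)
     (auto simp: lookup_B_plus_lin lookup_basis lookup_add split_paired_all)

text \<open>
  Both sides compare the roots of \<open>F\<close> and \<open>H\<close> and, if they agree, pass to the forests below them.
  The condition on \<open>G\<close> comes from \<open>F = \<emptyset>\<close>, where \<open>F \<unlhd> G = G\<close> while \<open>\<Delta>(G)\<close> is \<open>0\<close> for a disconnected
  \<open>G\<close>.
\<close>

lemma lookup_dual_prod_basis:
  assumes "size G \<le> 1"
  shows "Poly_Mapping.lookup (dual_prod_basis F G) H = Poly_Mapping.lookup (Delta_basis H) (F, G)"
proof (induction H arbitrary: F rule: measure_induct_rule[of forest_vertices])
  case (less H)
  have empty: "dual_prod_basis {#} G = basis G" by (simp add: dual_prod_basis_def)
  have not_tree: "F \<noteq> {#T#}" if "size F \<ge> 2" for F :: "'a forest" and T using that by auto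
  show ?case
  proof (cases H rule: forest_cases)
    case H: empty
    show ?thesis
      by (cases F rule: forest_cases)
         (auto simp: H empty lookup_basis dual_prod_basis_B_plus lookup_B_plus_lin
            dual_prod_basis_disconnected)
  next
    case H: (tree a t)
    show ?thesis
      by (cases F rule: forest_cases)
         (auto simp: H empty lookup_basis lookup_add dual_prod_basis_B_plus lookup_B_plus_lin
            lookup_B_plus_fst dual_prod_basis_disconnected Delta_basis_B_plus less not_tree)
  next
    case H: disconnected
    show ?thesis
      using H assms
      by (cases F rule: forest_cases)
         (auto simp: empty lookup_basis dual_prod_basis_B_plus lookup_B_plus_lin
            dual_prod_basis_disconnected not_tree)
  qed
qed

lemma dual_prod_basis_trees:
  assumes "F \<in> trees \<Omega>" "G \<in> trees \<Omega>"
  shows "(dual_prod_basis F G :: 'a forest \<Rightarrow>\<^sub>0 'k::field) \<in> free_on (trees \<Omega>)"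
proof -
  have "decorations F \<subseteq> \<Omega> \<Longrightarrow> (dual_prod_basis F G :: 'a forest \<Rightarrow>\<^sub>0 'k) \<in> free_on (trees \<Omega>)"
  proof (induction F rule: measure_induct_rule[of forest_vertices])
    case (less F)
    show ?case
    proof (cases F rule: forest_cases)
      case empty
      then show ?thesis using assms(2) by (auto simp: dual_prod_basis_def free_on_closed)
    next
      case (tree a f)
      then have "(dual_prod_basis f G :: 'a forest \<Rightarrow>\<^sub>0 'k) \<in> free_on (trees \<Omega>)" "a \<in> \<Omega>" using less by auto
      then show ?thesis
        by (auto simp: tree dual_prod_basis_B_plus trees_iff intro!: B_plus_lin_in_free_on)
    next
      case disconnected
      then show ?thesis by (simp add: dual_prod_basis_disconnected free_on_closed)
    qed
  qed
  then show ?thesis using assms(1) by (simp add: trees_iff)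
qed

lemma Delta_basis_trees:
  "decorations F \<subseteq> \<Omega> \<Longrightarrow>
    (Delta_basis F :: 'a forest \<times> 'a forest \<Rightarrow>\<^sub>0 'k::field) \<in> free_on (trees \<Omega> \<times> trees \<Omega>)"
proof (induction F rule: measure_induct_rule[of forest_vertices])
  case (less F)
  show ?case
  proof (cases F rule: forest_cases)
    case empty
    then show ?thesis by (simp add: trees_iff free_on_closed)
  next
    case (tree a f)
    then have a: "a \<in> \<Omega>" and f: "(Delta_basis f :: 'a forest \<times> 'a forest \<Rightarrow>\<^sub>0 'k) \<in> free_on (trees \<Omega> \<times> trees \<Omega>)"
      using less by auto
    have "(B_plus_fst a (Delta_basis f) :: 'a forest \<times> 'a forest \<Rightarrow>\<^sub>0 'k) \<in> free_on (trees \<Omega> \<times> trees \<Omega>)"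
    proof (rule tensor_map_in_free_on[OF _ _ f])
      show "B_plus_lin a x \<in> free_on (trees \<Omega>)" if "x \<in> free_on (trees \<Omega>)"
        for x :: "'a forest \<Rightarrow>\<^sub>0 'k"
        by (rule B_plus_lin_in_free_on[OF that]) (auto simp: trees_iff a)
    qed
    moreover have "({#}, {#B_plus a f#}) \<in> trees \<Omega> \<times> trees \<Omega>"
      using less.prems by (simp add: tree trees_iff)
    ultimately show ?thesis
      unfolding tree Delta_basis_B_plus by (intro free_on_closed)
  next
    case disconnected
    then show ?thesis by (simp add: free_on_closed)
  qed
qed

lemma dual_prod_simps [simp]:
  "(x + x') \<unlhd> y = x \<unlhd> y + x' \<unlhd> y"
  "x \<unlhd> (y + y') = x \<unlhd> y + x \<unlhd> y'"
  "scale c x \<unlhd> y = scale c (x \<unlhd> y)"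
  "x \<unlhd> scale c y = scale c (x \<unlhd> y)"
  "basis F \<unlhd> basis G = dual_prod_basis F G"
  by (simp_all add: dual_prod_def)

lemma adjoint_dual_prod_Delta:
  "adjoint_on (trees \<Omega> \<times> trees \<Omega>) (trees \<Omega>) (on_tensor (\<unlhd>)) Delta"
  by (rule adjoint_onI) (auto simp: linear_on_def lookup_dual_prod_basis trees_iff)

lemma on_tensor_dual_prod_in_free_on:
  "z \<in> free_on (trees \<Omega> \<times> trees \<Omega>) \<Longrightarrow> on_tensor (\<unlhd>) z \<in> free_on (trees \<Omega>)"
  by (rule linear_map_in_free_on[where f = "on_tensor (\<unlhd>)"]) (auto simp: linear_on_def dual_prod_basis_trees)

lemma Delta_in_free_on: "x \<in> free_on (trees \<Omega>) \<Longrightarrow> Delta x \<in> free_on (trees \<Omega> \<times> trees \<Omega>)"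
  by (rule linear_map_in_free_on[where f = "Delta"]) (auto simp: linear_on_def Delta_basis_trees trees_iff)

lemma on_tensor_shuffle_in_free_on:
  "z \<in> free_on (trees \<Omega> \<times> trees \<Omega>) \<Longrightarrow> on_tensor shuffle z \<in> free_on (trees \<Omega>)"
  by (rule linear_map_in_free_on[where f = "on_tensor shuffle"]) (auto simp: linear_on_def shuffle_basis_trees)


section \<open>The coproduct dual to the shuffle product\<close>

text \<open>
  By the grading, \<open>F\<close> and \<open>G\<close> together have as many vertices as some forest in the support of \<open>f\<close>,
  and there are finitely many trees of bounded size over a finite set.
\<close>

lemma finite_shuffle_support:
  assumes "finite \<Omega>"
  shows "finite {(F, G). F \<in> trees \<Omega> \<and> G \<in> trees \<Omega> \<and> pairing f (shuffle_basis F G) \<noteq> 0}"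
proof -
  define N where "N = forest_vertices ` Poly_Mapping.keys f"
  let ?S = "\<Union>n\<in>{..Max N}. {F \<in> trees \<Omega>. forest_vertices F = n}"
  have "(F, G) \<in> ?S \<times> ?S"
    if F: "F \<in> trees \<Omega>" and G: "G \<in> trees \<Omega>" and nz: "pairing f (shuffle_basis F G) \<noteq> 0" for F G
  proof -
    obtain H where H: "H \<in> Poly_Mapping.keys f" "Poly_Mapping.lookup (shuffle_basis F G) H \<noteq> (0::'b)"
      using nz unfolding pairing_def by (metis (no_types, lifting) mult_zero_right sum.neutral)
    have "forest_vertices H = forest_vertices F + forest_vertices G"
      using H(2) free_on_lookup_eq_0[OF shuffle_basis_graded[of F G]] by blast
    then have "forest_vertices F + forest_vertices G \<in> N" using H(1) by (force simp: N_def)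
    then have "forest_vertices F + forest_vertices G \<le> Max N"
      by (intro Max_ge) (simp_all add: N_def)
    then show ?thesis using F G by auto
  qed
  then have "{(F, G). F \<in> trees \<Omega> \<and> G \<in> trees \<Omega> \<and> pairing f (shuffle_basis F G) \<noteq> 0} \<subseteq> ?S \<times> ?S"
    by blast
  moreover have "finite ?S" using finite_trees_of_size[OF assms] by blast
  ultimately show ?thesis by (meson finite_SigmaI finite_subset)
qed

text \<open>
  The defining property prescribes the coefficients of \<open>\<Delta>\<^sup>*(f)\<close>; only finitely many of them are
  non-zero, so they define a vector, and it has the required property by bilinearity.
\<close>

lemma lookup_Delta_star:
  fixes f :: "'a forest \<Rightarrow>\<^sub>0 'k::field"
  assumes "finite \<Omega>"
  shows "Poly_Mapping.lookup (Delta_star \<Omega> f) (F, G) =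
    (if F \<in> trees \<Omega> \<and> G \<in> trees \<Omega> then pairing f (shuffle_basis F G) else 0)"
proof -
  define h where
    "h = (\<lambda>(F, G). if F \<in> trees \<Omega> \<and> G \<in> trees \<Omega> then pairing f (shuffle_basis F G) else 0)"
  have "{p. h p \<noteq> 0} =
      {(F, G). F \<in> trees \<Omega> \<and> G \<in> trees \<Omega> \<and> pairing f (shuffle_basis F G) \<noteq> 0}"
    by (auto simp: h_def split: if_splits)
  then have "finite {p. h p \<noteq> 0}" by (simp add: finite_shuffle_support[OF assms])
  \<comment> \<open>The vector with the prescribed coefficients.\<close>
  define d where "d = Abs_poly_mapping h"
  have "Poly_Mapping.lookup d = h" using \<open>finite {p. h p \<noteq> 0}\<close> by (simp add: d_def)
  then have d: "Poly_Mapping.lookup d (F, G) =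
      (if F \<in> trees \<Omega> \<and> G \<in> trees \<Omega> then pairing f (shuffle_basis F G) else 0)" for F G
    by (simp add: h_def)
  have "Delta_star \<Omega> f = d"
    unfolding Delta_star_def
  proof (rule the_equality, intro conjI ballI)
    show "d \<in> free_on (trees \<Omega> \<times> trees \<Omega>)"
      by (auto simp: free_on_def in_keys_iff d split: if_splits)
    have 1: "pairing d (tensor (basis F) y) = pairing f (shuffle (basis F) y)"
      if "F \<in> trees \<Omega>" "y \<in> T_space \<Omega>" for F y
      using that(2)
      by (induction rule: free_on_induct)
         (simp_all add: pairing_single_right d that(1))
    show "pairing d (tensor x y) = pairing f (shuffle x y)"
      if "x \<in> T_space \<Omega>" "y \<in> T_space \<Omega>" for x y
      using that(1)
      by (induction rule: free_on_induct) (simp_all add: 1 that(2))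
  next
    fix t :: "'a forest \<times> 'a forest \<Rightarrow>\<^sub>0 'k"
    assume t: "t \<in> free_on (trees \<Omega> \<times> trees \<Omega>) \<and>
      (\<forall>x\<in>T_space \<Omega>. \<forall>y\<in>T_space \<Omega>. pairing t (tensor x y) = pairing f (shuffle x y))"
    show "t = d"
    proof (rule poly_mapping_eqI)
      fix p :: "'a forest \<times> 'a forest"
      obtain F G where p: "p = (F, G)" by fastforce
      show "Poly_Mapping.lookup t p = Poly_Mapping.lookup d p"
      proof (cases "p \<in> trees \<Omega> \<times> trees \<Omega>")
        case True
        then have "F \<in> trees \<Omega>" "G \<in> trees \<Omega>" using p by simp_all
        then have "pairing t (tensor (basis F) (basis G)) = pairing f (shuffle (basis F) (basis G))"
          by (intro t[THEN conjunct2, rule_format] free_on_closed(2))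
        then show ?thesis using True p by (simp add: d pairing_single_right)
      next
        case False
        then have "Poly_Mapping.lookup t p = 0"
          by (rule free_on_lookup_eq_0[OF conjunct1[OF t]])
        then show ?thesis using False p by (auto simp: d)
      qed
    qed
  qed
  then show ?thesis by (simp add: d)
qed

lemma linear_map_Delta_star: "finite \<Omega> \<Longrightarrow> linear_map (Delta_star \<Omega>)"
  by (intro linear_mapI poly_mapping_eqI) (auto simp: lookup_Delta_star lookup_add split_paired_all)

lemma Delta_star_in_free_on: "finite \<Omega> \<Longrightarrow> Delta_star \<Omega> f \<in> free_on (trees \<Omega> \<times> trees \<Omega>)"
  by (auto simp: free_on_def in_keys_iff lookup_Delta_star split: if_splits)

lemma adjoint_Delta_star_shuffle:
  "finite \<Omega> \<Longrightarrow> adjoint_on (trees \<Omega>) (trees \<Omega> \<times> trees \<Omega>) (Delta_star \<Omega>) (on_tensor shuffle)"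
  by (rule adjoint_onI[OF linear_map_Delta_star])
     (auto simp: linear_on_def lookup_Delta_star pairing_basis)

lemma lookup_eval_fst:
  "Poly_Mapping.lookup (lin_ext (\<lambda>(b, c). scale (Poly_Mapping.lookup (basis b) e) (basis c)) u) H
     = Poly_Mapping.lookup u (e, H)"
  using free_on_UNIV[of u]
  by (induction u rule: free_on_induct) (auto simp: lookup_basis lookup_add split: if_splits)

lemma lookup_eval_snd:
  "Poly_Mapping.lookup (lin_ext (\<lambda>(b, c). scale (Poly_Mapping.lookup (basis c) e) (basis b)) u) H
     = Poly_Mapping.lookup u (H, e)"
  using free_on_UNIV[of u]
  by (induction u rule: free_on_induct) (auto simp: lookup_basis lookup_add split: if_splits)

text \<open>
  The coefficient of \<open>\<emptyset> \<otimes> H\<close> in \<open>\<Delta>\<^sup>*(f)\<close> is \<open>\<langle>f, \<emptyset> \<squnion> H\<rangle> = \<langle>f, H\<rangle>\<close>, and likewise for \<open>H \<otimes> \<emptyset>\<close>.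
\<close>

lemma Delta_star_counit:
  assumes "finite \<Omega>"
  shows "is_counit (trees \<Omega>) (Delta_star \<Omega>) (\<lambda>f. Poly_Mapping.lookup f {#})"
  unfolding is_counit_def
proof (intro conjI ballI)
  show "linear_on (free_on (trees \<Omega>)) (*) (\<lambda>f. Poly_Mapping.lookup f {#})"
    by (simp add: linear_on_def lookup_add)
next
  fix f assume f: "f \<in> free_on (trees \<Omega>)"
  have E: "{#} \<in> trees \<Omega>" by (simp add: trees_iff)
  show "lin_ext (\<lambda>(b, c). scale (Poly_Mapping.lookup (basis b) {#}) (basis c)) (Delta_star \<Omega> f) = f"
    by (rule poly_mapping_eqI, unfold lookup_eval_fst)
       (auto simp: lookup_Delta_star[OF assms] E pairing_single_right free_on_lookup_eq_0[OF f])
  show "lin_ext (\<lambda>(b, c). scale (Poly_Mapping.lookup (basis c) {#}) (basis b)) (Delta_star \<Omega> f) = f"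
    by (rule poly_mapping_eqI, unfold lookup_eval_snd)
       (auto simp: lookup_Delta_star[OF assms] E pairing_single_right free_on_lookup_eq_0[OF f])
qed

text \<open>
  Taking adjoints reverses the order of composition, so it turns the two sides into the two sides
  of \<open>Delta_on_tensor_shuffle\<close>, which are equal; and maps with equal adjoints are equal.
\<close>

lemma Delta_star_on_tensor_dual_prod:
  fixes z :: "'a forest \<times> 'a forest \<Rightarrow>\<^sub>0 'k::field"
  assumes fin: "finite \<Omega>" and z: "z \<in> free_on (trees \<Omega> \<times> trees \<Omega>)"
  shows "Delta_star \<Omega> (on_tensor (\<unlhd>) z) =
    tensor_map (on_tensor (\<unlhd>)) (on_tensor (\<unlhd>)) (tau23 (tensor_map (Delta_star \<Omega>) (Delta_star \<Omega>) z))"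
proof -
  let ?X = "trees \<Omega>"
  let ?P = "on_tensor (\<unlhd>) :: ('a forest \<times> 'a forest \<Rightarrow>\<^sub>0 'k) \<Rightarrow> _"
  let ?D = "Delta_star \<Omega> :: ('a forest \<Rightarrow>\<^sub>0 'k) \<Rightarrow> _"
  note maps = Delta_star_in_free_on[OF fin] on_tensor_dual_prod_in_free_on Delta_in_free_on
    on_tensor_shuffle_in_free_on
  have PP: "tensor_map ?P ?P w \<in> free_on (?X \<times> ?X)"
    and SS: "tensor_map (on_tensor shuffle) (on_tensor shuffle) w \<in> free_on (?X \<times> ?X)"
    if "w \<in> free_on ((?X \<times> ?X) \<times> (?X \<times> ?X))" for w :: "_ \<Rightarrow>\<^sub>0 'k"
    by (rule tensor_map_in_free_on[OF _ _ that, where f = ?P and g = ?P];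
        rule maps; assumption)
       (rule tensor_map_in_free_on[OF _ _ that, where f = "on_tensor shuffle" and g = "on_tensor shuffle"];
        rule maps; assumption)
  have DD: "tensor_map ?D ?D w \<in> free_on ((?X \<times> ?X) \<times> (?X \<times> ?X))"
    and DeltaDelta: "tensor_map Delta Delta w \<in> free_on ((?X \<times> ?X) \<times> (?X \<times> ?X))"
    if "w \<in> free_on (?X \<times> ?X)" for w :: "_ \<Rightarrow>\<^sub>0 'k"
    by (rule tensor_map_in_free_on[OF _ _ that, where f = ?D and g = ?D]; rule maps)
       (rule tensor_map_in_free_on[OF _ _ that, where f = Delta and g = Delta];
        rule maps; assumption)
  note adj_P = adjoint_dual_prod_Delta[of \<Omega>, where 'b = 'k]
  note adj_D = adjoint_Delta_star_shuffle[OF fin, where 'b = 'k]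
  have lhs: "adjoint_on (?X \<times> ?X) (?X \<times> ?X) (\<lambda>z. ?D (?P z)) (\<lambda>z. Delta (on_tensor shuffle z))"
    by (rule adjoint_on_compose[OF adj_P adj_D]) (simp_all add: maps)
  have tau_DD: "adjoint_on (?X \<times> ?X) ((?X \<times> ?X) \<times> (?X \<times> ?X))
      (\<lambda>z. tau23 (tensor_map ?D ?D z))
      (\<lambda>z. tensor_map (on_tensor shuffle) (on_tensor shuffle) (tau23 z))"
    by (rule adjoint_on_compose[OF adjoint_on_tensor_map[OF adj_D adj_D] adjoint_on_tau23])
       (simp_all add: DD tau23_in_free_on)
  have rhs: "adjoint_on (?X \<times> ?X) (?X \<times> ?X)
      (\<lambda>z. tensor_map ?P ?P (tau23 (tensor_map ?D ?D z)))
      (\<lambda>z. tensor_map (on_tensor shuffle) (on_tensor shuffle) (tau23 (tensor_map Delta Delta z)))"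
    by (rule adjoint_on_compose[OF tau_DD adjoint_on_tensor_map[OF adj_P adj_P]])
       (simp_all add: DD DeltaDelta tau23_in_free_on)
  show ?thesis
    by (rule adjoint_on_unique[OF lhs rhs Delta_on_tensor_shuffle _ _ z])
       (simp_all add: maps PP DD tau23_in_free_on z)
qed

theorem theorem2p10:
  fixes \<Omega> :: "'a set"
  assumes "finite \<Omega>"
  shows
    "is_bialgebra (trees \<Omega>)
       ((\<unlhd>) :: ('a forest \<Rightarrow>\<^sub>0 'k::field) \<Rightarrow> ('a forest \<Rightarrow>\<^sub>0 'k) \<Rightarrow> ('a forest \<Rightarrow>\<^sub>0 'k))
       (Delta_star \<Omega>) \<and>
     (\<forall>f \<in> (T_dual \<Omega> :: ('a forest \<Rightarrow>\<^sub>0 'k) set). \<forall>x \<in> T_space \<Omega>. \<forall>y \<in> T_space \<Omega>.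
       pairing (Delta_star \<Omega> f) (tensor x y) = pairing f (shuffle x y)) \<and>
     (\<forall>f \<in> (T_dual \<Omega> :: ('a forest \<Rightarrow>\<^sub>0 'k) set). \<forall>g \<in> T_dual \<Omega>. \<forall>x \<in> T_space \<Omega>.
       pairing (f \<unlhd> g) x = pairing (tensor f g) (Delta x))"
proof -
  \<comment> \<open>Bilinear maps as linear maps on the tensor product, where adjointness is stated.\<close>
  have prod: "f \<unlhd> g = on_tensor (\<unlhd>) (tensor f g)"
    and shuffle: "shuffle f g = on_tensor shuffle (tensor f g)" for f g :: "'a forest \<Rightarrow>\<^sub>0 'k"
    unfolding dual_prod_def shuffle_def by (subst on_tensor_bilin_ext, rule refl)+
  have bialgebra: "is_bialgebra (trees \<Omega>)
      ((\<unlhd>) :: ('a forest \<Rightarrow>\<^sub>0 'k) \<Rightarrow> ('a forest \<Rightarrow>\<^sub>0 'k) \<Rightarrow> ('a forest \<Rightarrow>\<^sub>0 'k)) (Delta_star \<Omega>)"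
    unfolding is_bialgebra_def Let_def
  proof (intro conjI ballI)
    show "f \<unlhd> g \<in> T_space \<Omega>" if "f \<in> T_space \<Omega>" "g \<in> T_space \<Omega>"
      for f g :: "'a forest \<Rightarrow>\<^sub>0 'k"
      by (subst prod) (intro on_tensor_dual_prod_in_free_on tensor_in_free_on that)
    show "linear_on (T_space \<Omega>) scale (Delta_star \<Omega> :: ('a forest \<Rightarrow>\<^sub>0 'k) \<Rightarrow> _)"
      using linear_map_Delta_star[OF assms, where 'b = 'k] by (simp add: linear_on_def)
    show "\<exists>\<epsilon> :: ('a forest \<Rightarrow>\<^sub>0 'k) \<Rightarrow> 'k. is_counit (trees \<Omega>) (Delta_star \<Omega>) \<epsilon>"
      using Delta_star_counit[OF assms] by blast
    fix z :: "'a forest \<times> 'a forest \<Rightarrow>\<^sub>0 'k"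
    assume "z \<in> free_on (trees \<Omega> \<times> trees \<Omega>)"
    then show "Delta_star \<Omega> (on_tensor (\<unlhd>) z) = tensor_map (on_tensor (\<unlhd>)) (on_tensor (\<unlhd>))
        (tau23 (tensor_map (Delta_star \<Omega>) (Delta_star \<Omega>) z))"
      by (rule Delta_star_on_tensor_dual_prod[OF assms])
  qed (simp_all add: linear_on_def Delta_star_in_free_on[OF assms])
  have shuffle_dual: "pairing (Delta_star \<Omega> f) (tensor x y) = pairing f (shuffle x y)"
    if "f \<in> T_dual \<Omega>" "x \<in> T_space \<Omega>" "y \<in> T_space \<Omega>" for f x y :: "'a forest \<Rightarrow>\<^sub>0 'k"
    by (subst shuffle, rule adjoint_Delta_star_shuffle[OF assms, unfolded adjoint_on_def, rule_format])
       (use that in \<open>simp_all add: T_dual_def tensor_in_free_on\<close>)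
  have prod_dual: "pairing (f \<unlhd> g) x = pairing (tensor f g) (Delta x)"
    if "f \<in> T_dual \<Omega>" "g \<in> T_dual \<Omega>" "x \<in> T_space \<Omega>" for f g x :: "'a forest \<Rightarrow>\<^sub>0 'k"
    by (subst prod, rule adjoint_dual_prod_Delta[unfolded adjoint_on_def, rule_format])
       (use that in \<open>simp_all add: T_dual_def tensor_in_free_on\<close>)
  show ?thesis
    by (intro conjI ballI bialgebra shuffle_dual prod_dual)
qed

end
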